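(* In the model described in the context, the conditional hit probability $\mathrm{P}^{\mathrm{hit,BS}}_{i}=\mathbb{P}(\mathrm{SINR}_i>\beta)$ of file $i$ under the best selection is $$\mathrm{P}^{\mathrm{hit,BS}}_{i}=1-\sum_{k=0}^{M-1}\sum_{t=0}^{M-1-k}R_{k+t,k}\,a_k b_t-\sum_{k=0}^{\infty}R_{M,k}\,a_k\left(1-\sum_{t=0}^{M-1-k}b_t\right)$$ (empty sums are $0$), where $$a_k=\frac{e^{-\lambda p_i\pi D^2}(\lambda p_i\pi D^2)^k}{k!},\qquad b_t=\frac{e^{-\lambda(1-p_i)\pi D^2}(\lambda(1-p_i)\pi D^2)^t}{t!},$$ and $$R_{l,k}=\mathbb{E}\left\{\left(1-\sum_{m=0}^{M-l}\frac{\beta^m(\mathcal{I}_o+\sigma^2)^m}{P^m m!}\int_0^{D+\|\mathbf{x}_o\|}y^{\alpha_i m}\exp\left(-\frac{\beta(\mathcal{I}_o+\sigma^2)y^{\alpha_i}}{P}\right)f^{\|\mathbf{x}_o\|}(y)\,\mathrm{d}y\right)^k\right\}.$$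
   Context: Parameters: $\lambda,\lambda_p,D,P,\beta>0$, $\sigma^2\ge 0$, $d_g\ge0$, pathloss exponents $0<\alpha_i<\alpha_o$ (the subscript in $\alpha_i$ is a label, unrelated to the file index $i$), $M\ge1$ an integer, $0\le p_i\le 1$, and $\mathbf{x}_o\in\mathbb{R}^2$ with $\|\mathbf{x}_o\|\le D$. The user of interest is at the origin. The radio units (RUs) of the representative cloud form a homogeneous Poisson point process $\Phi_{\mathbf{x}_o}$ of intensity $\lambda$ on the disk of center $\mathbf{x}_o$ and radius $D$. Each RU independently caches file $i$ with probability $p_i$; $\Phi^i_{\mathbf{x}_o}$ is the set of RUs caching file $i$. $n(\cdot)$ is the number of elements, and the number of active RUs is $n(\mathcal{A}_{\mathbf{x}_o})=\min\{M,n(\Phi_{\mathbf{x}_o})\}$. Given $n(\mathcal{A}_{\mathbf{x}_o})=l$, the gains $g_{\mathbf{y}}$, $\mathbf{y}\in\Phi^i_{\mathbf{x}_o}$, are i.i.d., independent of the locations and of $\mathcal{I}_o$, with $\mathbb{P}(g_{\mathbf{y}}>t)=\sum_{m=0}^{M-l}\frac{t^m}{m!}e^{-t}$, $t\ge0$. Best selection: the serving RU maximizes $P g_{\mathbf{y}}\|\mathbf{y}\|^{-\alpha_i}$ over $\mathbf{y}\in\Phi^i_{\mathbf{x}_o}$, so that, if $\Phi^i_{\mathbf{x}_o}\ne\emptyset$, $$\mathrm{SINR}_i=\frac{\max_{\mathbf{y}\in\Phi^i_{\mathbf{x}_o}}P g_{\mathbf{y}}\|\mathbf{y}\|^{-\alpha_i}}{\sigma^2+\mathcal{I}_o},$$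 and if $\Phi^i_{\mathbf{x}_o}=\emptyset$ the event $\mathrm{SINR}_i>\beta$ does not occur. $\mathcal{I}_o$ is the out of cloud interference, independent of the representative cloud: $$\mathcal{I}_o=\sum_{\mathbf{x}\in\Phi_p}\sum_{\mathbf{y}\in\mathcal{A}_{\mathbf{x}}}P f_{\mathbf{y}}\|\mathbf{y}\|^{-\alpha_o},$$ where $\Phi_p$ is a homogeneous Poisson point process on $\mathbb{R}^2$ of intensity $\lambda_p$; given $\Phi_p$, for each $\mathbf{x}\in\Phi_p$, $\Phi_{\mathbf{x}}$ is an independent homogeneous Poisson point process of intensity $\lambda$ on the disk of center $\mathbf{x}$ and radius $D$; $\mathcal{A}_{\mathbf{x}}$ consists of $\min\{M,n\}$ of the $n$ points of $\Phi_{\mathbf{x}}$ at distance more than $d_g$ from the origin, chosen uniformly at random; the $f_{\mathbf{y}}$ are i.i.d. unit-mean exponential, independent of the locations. The function $f^{\|\mathbf{x}_o\|}$ (the density of the distance to the origin of a uniformly distributed point of the disk of center $\mathbf{x}_o$ and radius $D$) is $$f^{\|\mathbf{x}_o\|}(y)=\begin{cases}\frac{2y}{D^2}, & 0\le y<D-\|\mathbf{x}_o\|,\\ \frac{1}{\pi D^2}\frac{\partial \mathcal{B}_{\|\mathbf{x}_o\|}(y)}{\partial y}, & D-\|\mathbf{x}_o\|\le y<D+\|\mathbf{x}_o\|,\\ 0,& y\ge D+\|\mathbf{x}_o\|,\end{cases}$$ where $$\mathcal{B}_{x}(y)=D^2\cos^{-1}\!\left(\frac{D^2+x^2-y^2}{2xD}\right)+y^2\cos^{-1}\!\left(\frac{y^2+x^2-D^2}{2xy}\right)-\frac12\sqrt{\left[(y+x)^2-D^2\right]\left[D^2-(y-x)^2\right]}.$$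 *)

theory Defs
  imports "HOL-Probability.Probability"
begin

section \<open>Homogeneous Poisson point processes and conditionally independent marks\<close>

text \<open>The homogeneous Poisson point process of intensity \<open>lam\<close> on the region \<open>W\<close>, as a random set
  \<open>\<Phi>\<close>. The Poisson weights are written out because \<^const>\<open>poisson_pmf\<close> is only specified for a
  positive rate, while the mean is \<open>0\<close> for sets that meet \<open>W\<close> in a null set.\<close>

definition homogeneous_ppp ::
  "'w measure \<Rightarrow> real \<Rightarrow> 'a::euclidean_space set \<Rightarrow> ('w \<Rightarrow> 'a set) \<Rightarrow> bool" where
  "homogeneous_ppp S lam W \<Phi> \<longleftrightarrow>
    (AE \<omega> in S. \<Phi> \<omega> \<subseteq> W \<and> (\<forall>B. bounded B \<longrightarrow> finite (\<Phi> \<omega> \<inter> B))) \<and>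
    (\<forall>B\<in>sets borel. bounded B \<longrightarrow>
       (\<lambda>\<omega>. card (\<Phi> \<omega> \<inter> B)) \<in> S \<rightarrow>\<^sub>M count_space UNIV \<and>
       (\<forall>k. measure S {\<omega>\<in>space S. card (\<Phi> \<omega> \<inter> B) = k} =
          exp (- (lam * measure lborel (B \<inter> W))) * (lam * measure lborel (B \<inter> W)) ^ k / fact k)) \<and>
    (\<forall>J (B :: nat \<Rightarrow> 'a set). finite J \<longrightarrow> (\<forall>i\<in>J. B i \<in> sets borel \<and> bounded (B i)) \<longrightarrow>
       disjoint_family_on B J \<longrightarrow>
       prob_space.indep_vars S (\<lambda>_. count_space UNIV) (\<lambda>i \<omega>. card (\<Phi> \<omega> \<inter> B i)) J)"

text \<open>Independence of two random variables as in \<^const>\<open>prob_space.indep_var\<close>, which however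
  requires both to take values in the same type.\<close>

definition indep_rvs ::
  "'w measure \<Rightarrow> 'v measure \<Rightarrow> ('w \<Rightarrow> 'v) \<Rightarrow> 'b measure \<Rightarrow> ('w \<Rightarrow> 'b) \<Rightarrow> bool" where
  "indep_rvs S N V L W \<longleftrightarrow>
    V \<in> S \<rightarrow>\<^sub>M N \<and> W \<in> S \<rightarrow>\<^sub>M L \<and>
    prob_space.indep_set S {V -` A \<inter> space S |A. A \<in> sets N} {W -` A \<inter> space S |A. A \<in> sets L}"

text \<open>Conditionally on the random variable \<open>V\<close>, the marks \<open>\<xi> i\<close> with \<open>i \<in> I \<omega>\<close> are independent and
  \<open>\<xi> i\<close> has the law \<open>\<kappa> i \<omega>\<close>. The random index set \<open>I\<close> and the laws \<open>\<kappa>\<close> are meant to be functions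
  of \<open>V\<close>. Marks whose index lies outside \<open>I \<omega>\<close> are unconstrained.\<close>

definition cond_indep_marks ::
  "'w measure \<Rightarrow> 'v measure \<Rightarrow> ('w \<Rightarrow> 'v) \<Rightarrow> 'b measure \<Rightarrow> ('w \<Rightarrow> 'i set) \<Rightarrow>
   ('i \<Rightarrow> 'w \<Rightarrow> 'b measure) \<Rightarrow> ('i \<Rightarrow> 'w \<Rightarrow> 'b) \<Rightarrow> bool" where
  "cond_indep_marks S N V L I \<kappa> \<xi> \<longleftrightarrow>
    V \<in> S \<rightarrow>\<^sub>M N \<and> (\<forall>i. \<xi> i \<in> S \<rightarrow>\<^sub>M L) \<and>
    (\<forall>E\<in>sets N. \<forall>J A. finite J \<longrightarrow> (\<forall>\<omega>\<in>space S. V \<omega> \<in> E \<longrightarrow> J \<subseteq> I \<omega>) \<longrightarrow>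
       (\<forall>i\<in>J. A i \<in> sets L) \<longrightarrow>
       emeasure S {\<omega>\<in>space S. V \<omega> \<in> E \<and> (\<forall>i\<in>J. \<xi> i \<omega> \<in> A i)} =
       (\<integral>\<^sup>+\<omega>. indicator {\<omega>\<in>space S. V \<omega> \<in> E} \<omega> * (\<Prod>i\<in>J. emeasure (\<kappa> i \<omega>) (A i)) \<partial>S))"

text \<open>Finite point processes are given by their number of points and an enumeration of the points.\<close>

definition points :: "('w \<Rightarrow> nat) \<Rightarrow> (nat \<Rightarrow> 'w \<Rightarrow> 'a) \<Rightarrow> 'w \<Rightarrow> 'a set" where
  "points num loc \<omega> = (\<lambda>j. loc j \<omega>) ` {..<num \<omega>}"

abbreviation seq_space :: "'b measure \<Rightarrow> (nat \<Rightarrow> 'b) measure" where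
  "seq_space L \<equiv> (\<Pi>\<^sub>M j\<in>UNIV. L)"

abbreviation config_space :: "(nat \<times> (nat \<Rightarrow> 'a::euclidean_space)) measure" where
  "config_space \<equiv> count_space UNIV \<Otimes>\<^sub>M seq_space borel"

section \<open>The representative cloud\<close>

definition gain_tail :: "nat \<Rightarrow> nat \<Rightarrow> real \<Rightarrow> real" where
  "gain_tail M l t = (if t < 0 then 1 else (\<Sum>m\<le>M - l. t ^ m / fact m * exp (- t)))"

definition gain_law :: "nat \<Rightarrow> nat \<Rightarrow> real measure" where
  "gain_law M l = interval_measure (\<lambda>t. 1 - gain_tail M l t)"

lemma gain_law_erlang: "gain_law M l = density lborel (erlang_density (M - l) 1)"
proof -
  let ?E = "density lborel (erlang_density (M - l) 1)"
  interpret E: prob_space ?E by (rule prob_space_erlang_density) simp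
  interpret E: real_distribution ?E by unfold_locales simp_all
  have cdf_eq: "cdf ?E = (\<lambda>t. 1 - gain_tail M l t)"
  proof
    fix t :: real
    have "emeasure ?E {..t} = ennreal (erlang_CDF (M - l) 1 t)"
      by (rule emeasure_erlang_density) simp
    moreover have "0 \<le> erlang_CDF (M - l) 1 t"
      by (rule erlang_CDF_nonneg) simp
    ultimately have "cdf ?E t = erlang_CDF (M - l) 1 t"
      by (simp add: cdf_def measure_def)
    also have "\<dots> = 1 - gain_tail M l t"
      by (auto simp: erlang_CDF_def gain_tail_def field_simps intro!: sum.cong)
    finally show "cdf ?E t = 1 - gain_tail M l t" .
  qed
  note cdf_rules = E.cdf_nondecreasing E.cdf_is_right_cont E.cdf_lim_at_bot E.cdf_lim_at_top_prob
  have "interval_measure (cdf ?E) = ?E"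
    by (rule cdf_unique[OF real_distribution_interval_measure[OF cdf_rules]
          E.real_distribution_axioms cdf_interval_measure[OF cdf_rules(1-3)]])
  then show ?thesis
    unfolding gain_law_def cdf_eq by simp
qed

lemma prob_space_gain_law: "prob_space (gain_law M l)"
  unfolding gain_law_erlang by (rule prob_space_erlang_density) simp

lemma gain_law_tail:
  assumes "0 \<le> t"
  shows "measure (gain_law M l) {t<..} = (\<Sum>m\<le>M - l. t ^ m / fact m * exp (- t))"
proof -
  interpret prob_space "gain_law M l" by (rule prob_space_gain_law)
  have "measure (gain_law M l) {..t} = erlang_CDF (M - l) 1 t"
    unfolding gain_law_erlang measure_def
    by (subst emeasure_erlang_density) (simp_all add: erlang_CDF_nonneg)
  moreover have "{t<..} = space (gain_law M l) - {..t}"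
    by (auto simp: gain_law_def)
  moreover have "{..t} \<in> events"
    by (simp add: gain_law_def)
  ultimately have "measure (gain_law M l) {t<..} = 1 - erlang_CDF (M - l) 1 t"
    by (simp add: prob_compl)
  then show ?thesis
    using assms by (auto simp: erlang_CDF_def field_simps intro!: sum.cong)
qed

definition caching :: "('w \<Rightarrow> nat) \<Rightarrow> (nat \<Rightarrow> 'w \<Rightarrow> bool) \<Rightarrow> 'w \<Rightarrow> nat set" where
  "caching num c \<omega> = {j. j < num \<omega> \<and> c j \<omega>}"

text \<open>The ratio is taken in \<^typ>\<open>ennreal\<close>, so it is \<open>0\<close> where the interference is infinite.\<close>

definition sinr_best ::
  "real \<Rightarrow> real \<Rightarrow> real \<Rightarrow> ('w \<Rightarrow> nat) \<Rightarrow> (nat \<Rightarrow> 'w \<Rightarrow> 'a::real_normed_vector) \<Rightarrow>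
   (nat \<Rightarrow> 'w \<Rightarrow> bool) \<Rightarrow> (nat \<Rightarrow> 'w \<Rightarrow> real) \<Rightarrow> ('w \<Rightarrow> ennreal) \<Rightarrow> 'w \<Rightarrow> ennreal" where
  "sinr_best P \<alpha> \<sigma>2 num loc c g Io \<omega> =
    (MAX j\<in>caching num c \<omega>. ennreal (P * g j \<omega> * norm (loc j \<omega>) powr - \<alpha>)) / (ennreal \<sigma>2 + Io \<omega>)"

section \<open>The out of cloud interference\<close>

text \<open>The cloud centers are \<open>ctr 0, ctr 1, \<dots>\<close>, and RU \<open>j\<close> of cloud \<open>n\<close> is located at
  \<open>ctr n \<omega> + off n j \<omega>\<close>.\<close>

definition far_rus ::
  "real \<Rightarrow> (nat \<Rightarrow> 'w \<Rightarrow> 'a::real_normed_vector) \<Rightarrow> (nat \<Rightarrow> 'w \<Rightarrow> nat) \<Rightarrow>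
   (nat \<Rightarrow> nat \<Rightarrow> 'w \<Rightarrow> 'a) \<Rightarrow> nat \<Rightarrow> 'w \<Rightarrow> nat set" where
  "far_rus dg ctr cnum off n \<omega> = {j. j < cnum n \<omega> \<and> dg < norm (ctr n \<omega> + off n j \<omega>)}"

definition active_choices :: "nat \<Rightarrow> nat set \<Rightarrow> nat set set" where
  "active_choices M J = {T. T \<subseteq> J \<and> card T = min M (card J)}"

text \<open>The interference is \<^typ>\<open>ennreal\<close>-valued, since the sum diverges almost surely if \<open>\<alpha> \<le> 2\<close>.\<close>

definition interference ::
  "real \<Rightarrow> real \<Rightarrow> (nat \<Rightarrow> 'w \<Rightarrow> 'a::real_normed_vector) \<Rightarrow> (nat \<Rightarrow> nat \<Rightarrow> 'w \<Rightarrow> 'a) \<Rightarrow>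
   (nat \<Rightarrow> 'w \<Rightarrow> nat set) \<Rightarrow> (nat \<Rightarrow> nat \<Rightarrow> 'w \<Rightarrow> real) \<Rightarrow> 'w \<Rightarrow> ennreal" where
  "interference P \<alpha> ctr off act fad \<omega> =
    (\<Sum>n. \<Sum>j\<in>act n \<omega>. ennreal (P * fad n j \<omega> * norm (ctr n \<omega> + off n j \<omega>) powr - \<alpha>))"

section \<open>The quantities in the hit probability formula\<close>

definition lens_area :: "real \<Rightarrow> real \<Rightarrow> real \<Rightarrow> real" where
  "lens_area D x y =
     D\<^sup>2 * arccos ((D\<^sup>2 + x\<^sup>2 - y\<^sup>2) / (2 * x * D)) + y\<^sup>2 * arccos ((y\<^sup>2 + x\<^sup>2 - D\<^sup>2) / (2 * x * y))
     - 1 / 2 * sqrt (((y + x)\<^sup>2 - D\<^sup>2) * (D\<^sup>2 - (y - x)\<^sup>2))"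

definition dist_density :: "real \<Rightarrow> real \<Rightarrow> real \<Rightarrow> real" where
  "dist_density D x y =
    (if 0 \<le> y \<and> y < D - x then 2 * y / D\<^sup>2
     else if D - x \<le> y \<and> y < D + x then 1 / (pi * D\<^sup>2) * deriv (lens_area D x) y
     else 0)"

text \<open>\<open>s\<close> stands for \<open>\<I>\<^sub>o + \<sigma>\<^sup>2\<close> and \<open>x\<close> for the norm of the cloud center.\<close>

definition miss_factor :: "nat \<Rightarrow> real \<Rightarrow> real \<Rightarrow> real \<Rightarrow> real \<Rightarrow> real \<Rightarrow> nat \<Rightarrow> real \<Rightarrow> real" where
  "miss_factor M P \<beta> \<alpha> D x l s =
    1 - (\<Sum>m\<le>M - l. \<beta> ^ m * s ^ m / (P ^ m * fact m) *
          (LBINT y:{0..D + x}. y powr (\<alpha> * real m) * exp (- (\<beta> * s * y powr \<alpha> / P)) * dist_density D x y))"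

text \<open>Where \<open>\<I>\<^sub>o = \<infinity>\<close>, the integrand is given its limit \<open>1\<close> for \<open>\<I>\<^sub>o \<rightarrow> \<infinity>\<close> (for \<open>y > 0\<close>,
  \<open>s\<^sup>m exp (- \<beta> s y\<^sup>\<alpha> / P)\<close> tends to \<open>0\<close> as \<open>s \<rightarrow> \<infinity>\<close>).\<close>

definition R_coeff ::
  "'w measure \<Rightarrow> ('w \<Rightarrow> ennreal) \<Rightarrow> nat \<Rightarrow> real \<Rightarrow> real \<Rightarrow> real \<Rightarrow> real \<Rightarrow> real \<Rightarrow> real \<Rightarrow> nat \<Rightarrow> nat \<Rightarrow> real"
  where
  "R_coeff S Io M P \<beta> \<alpha> \<sigma>2 D x l k =
    (LINT \<omega>|S. (if Io \<omega> = \<infinity> then 1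
                 else miss_factor M P \<beta> \<alpha> D x l (enn2real (Io \<omega>) + \<sigma>2) ^ k))"

definition poisson_weight :: "real \<Rightarrow> nat \<Rightarrow> real" where
  "poisson_weight r k = exp (- r) * r ^ k / fact k"

end

theory Submission
  imports Defs "HOL-Complex_Analysis.Cauchy_Integral_Formula"
begin

text \<open>Given the number \<open>n\<close> of RUs, their locations and caching marks and the interference, the file is
  missed iff every gain of a caching RU lies below a threshold, so the conditional probability of a
  miss is a product over the caching RUs. Averaging over the caching marks turns it into
  \<open>\<Prod>j<n. (p h(y\<^sub>j) + 1 - p)\<close> for a function \<open>h\<close> of the location alone. The expectation of such a
  symmetric product over a Poisson process on the event of \<open>n\<close> points is read off the probability
  generating functional as a power series coefficient, and only involves the mean of \<open>h\<close> over the disk;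
  by the area of the intersection of two disks this mean is an integral against \<^const>\<open>dist_density\<close>. Expanding the
  \<open>n\<close>-th power by the binomial theorem separates the Poisson weights of the caching and of the other
  RUs; the terms with \<open>n \<ge> M\<close> are resummed by a Cauchy product.\<close>

section \<open>The distance to the origin of a uniform point of a disk\<close>

text \<open>The enumeration \<open>loc\<close> is arbitrary: \<open>homogeneous_ppp\<close> speaks
  only about counts in sets, and the labels may depend on the configuration, so given
  \<open>num\<close> the variables \<open>loc j\<close> need not be i.i.d. uniform. Only functionals
  symmetric in the points are determined. A caching pattern J singles out labels and destroys the
  symmetry; hence the miss probability on one pattern is never evaluated, only the sum over all J
  with weights p^|J| (1-p)^(n-|J|), which is symmetric again. The same obstacle leads to the
  generating functional: replacing h by z h multiplies the contribution of n points by z^n, so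
  comparing coefficients isolates the event of n points without any conditional law of the
  locations. The number n has to be isolated because the gain law depends on \<open>min M n\<close>.

  The density is given through \<open>deriv\<close>, and this derivative is never computed: sign,
  measurability and integral of the density all come from the overlap area, which is monotone,
  continuous and differentiable off two radii.\<close>

lemma measurable_vec_real_2 [measurable]:
  "(\<lambda>(a, b). (\<chi> i. if i = 1 then a else b) :: real ^ 2) \<in> borel_measurable (lborel \<Otimes>\<^sub>M lborel)"
  by (subst borel_measurable_euclidean_space) (auto simp: Basis_vec_def inner_axis split_beta)

text \<open>Gives access to iterated integration in the plane, so that the area of a lens can be
  found from the lengths of its vertical sections. It is enough to compare both measures on
  boxes.\<close>

lemma lborel_real_2:
  "(lborel :: (real ^ 2) measure) =
     distr (lborel \<Otimes>\<^sub>M lborel) borel (\<lambda>(a, b). \<chi> i. if i = 1 then a else b)"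
proof (rule lborel_eqI)
  have B: "Basis = {axis 1 (1::real), axis 2 1 :: real ^ 2}"
    by (auto simp: Basis_vec_def UNIV_2)
  have ne: "axis 1 (1::real) \<noteq> (axis 2 1 :: real ^ 2)"
    by (simp add: axis_eq_axis)
  show "emeasure (distr (lborel \<Otimes>\<^sub>M lborel) borel (\<lambda>(a, b). \<chi> i. if i = 1 then a else b)) (box l u)
     = ennreal (\<Prod>b\<in>Basis. (u - l) \<bullet> b)" if lu: "\<And>b. b \<in> Basis \<Longrightarrow> l \<bullet> b \<le> u \<bullet> b" for l u :: "real ^ 2"
  proof -
    have le: "l $ 1 \<le> u $ 1" "l $ 2 \<le> u $ 2"
      using lu[of "axis 1 1"] lu[of "axis 2 1"] by (auto simp: B inner_axis)
    have "(\<lambda>(a, b). (\<chi> i. if i = 1 then a else b) :: real ^ 2) -` box l u \<inter> space (lborel \<Otimes>\<^sub>M lborel)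
       = {l $ 1<..<u $ 1} \<times> {l $ 2<..<u $ 2}"
      by (auto simp: mem_box B inner_axis space_pair_measure)
    then show ?thesis
      using le ne by (simp add: emeasure_distr lborel.emeasure_pair_measure_Times B inner_axis ennreal_mult)
  qed
qed simp

text \<open>Serves to rotate the cloud center onto the first axis. An orthogonal matrix has
  determinant 1 or -1.\<close>

lemma measure_orthogonal_image_2:
  fixes f :: "real ^ 2 \<Rightarrow> real ^ 2"
  assumes "orthogonal_transformation f" "bounded A" "A \<in> sets borel" "f ` A \<in> sets borel"
  shows "measure lborel (f ` A) = measure lborel A"
proof -
  have "measure lebesgue (f ` A) = \<bar>det (matrix f)\<bar> * measure lebesgue A"
    using assms by (intro measure_lebesgue_linear_transformation)
      (auto simp: orthogonal_transformation_def)
  moreover have "\<bar>det (matrix f)\<bar> = 1"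
    using assms(1) by (auto simp: orthogonal_transformation_matrix dest!: det_orthogonal_matrix)
  ultimately show ?thesis
    using assms by simp
qed

text \<open>The integrand is the chord length of a disk of radius r. Its antiderivative need not be
  differentiable at c - r and c + r, so the form of the fundamental theorem that asks for a
  derivative only in the interior is used.\<close>

lemma has_integral_semicircle:
  fixes r a b c :: real
  assumes r: "0 < r" and ab: "c - r \<le> a" "a \<le> b" "b \<le> c + r"
  shows "((\<lambda>u. 2 * sqrt (r\<^sup>2 - (u - c)\<^sup>2)) has_integral
     ((b - c) * sqrt (r\<^sup>2 - (b - c)\<^sup>2) + r\<^sup>2 * arcsin ((b - c) / r)) -
     ((a - c) * sqrt (r\<^sup>2 - (a - c)\<^sup>2) + r\<^sup>2 * arcsin ((a - c) / r))) {a..b}"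
proof (rule fundamental_theorem_of_calculus_interior)
  have "-1 \<le> (u - c) / r" "(u - c) / r \<le> 1" if "u \<in> {a..b}" for u
    using that ab r by (auto simp: field_simps)
  then show "continuous_on {a..b} (\<lambda>b. (b - c) * sqrt (r\<^sup>2 - (b - c)\<^sup>2) + r\<^sup>2 * arcsin ((b - c) / r))"
    using r by (intro continuous_intros) auto
  fix u assume u: "u \<in> {a<..<b}"
  then have u': "-1 < (u - c) / r" "(u - c) / r < 1" "\<bar>u - c\<bar> < r"
    using ab r by (auto simp: field_simps)
  then have pos: "r\<^sup>2 - (u - c)\<^sup>2 > 0"
    using power_strict_mono[OF u'(3), of 2] by simp
  have "1 - ((u - c) / r)\<^sup>2 = (r\<^sup>2 - (u - c)\<^sup>2) / r\<^sup>2"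
    using r by (subst power_divide) (simp add: diff_divide_distrib)
  then have s: "sqrt (1 - ((u - c) / r)\<^sup>2) = sqrt (r\<^sup>2 - (u - c)\<^sup>2) / r"
    using r by (simp add: real_sqrt_divide)
  show "((\<lambda>b. (b - c) * sqrt (r\<^sup>2 - (b - c)\<^sup>2) + r\<^sup>2 * arcsin ((b - c) / r)) has_vector_derivative
      2 * sqrt (r\<^sup>2 - (u - c)\<^sup>2)) (at u)"
    unfolding has_real_derivative_iff_has_vector_derivative[symmetric]
    using pos u'(1,2) r
    by (auto intro!: derivative_eq_intros simp: s) (simp add: divide_simps, simp add: algebra_simps power2_eq_square)
qed (use ab in auto)

text \<open>Cavalieri's principle: the vertical section at abscissa a is an interval of half length
  sqrt (m a), so the area is the integral of one circle's chord length up to the crossing abscissa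
  and of the other's beyond it.\<close>

lemma measure_disk_inter_eq_lens_area:
  fixes D x y :: real
  assumes D: "0 < D" and x: "0 < x" and y: "0 < y" "\<bar>D - x\<bar> < y" "y < D + x"
  shows "measure lborel (cball (axis 1 x) D \<inter> cball 0 y :: (real ^ 2) set) = lens_area D x y"
proof -
  let ?A = "cball (axis 1 x) D \<inter> cball 0 y :: (real ^ 2) set"
  define m where "m u = min (D\<^sup>2 - (u - x)\<^sup>2) (y\<^sup>2 - u\<^sup>2)" for u
  \<comment> \<open>the abscissa of the two intersection points of the circles; the disk around \<open>(x, 0)\<close> bounds the
    vertical sections to the left of it, the disk around the origin those to the right\<close>
  define u0 where "u0 = (y\<^sup>2 + x\<^sup>2 - D\<^sup>2) / (2 * x)"
  have nrm: "norm v \<le> r \<longleftrightarrow> (v $ 1)\<^sup>2 + (v $ 2)\<^sup>2 \<le> r\<^sup>2" if "0 < r" for v :: "real ^ 2" and r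
    using that by (simp add: norm_vec_def L2_set_def UNIV_2 real_sqrt_le_iff')
  have A: "?A = {v. (v $ 1 - x)\<^sup>2 + (v $ 2)\<^sup>2 \<le> D\<^sup>2 \<and> (v $ 1)\<^sup>2 + (v $ 2)\<^sup>2 \<le> y\<^sup>2}"
    using D y by (auto simp: dist_norm nrm axis_def power2_commute[of x])
  \<comment> \<open>The circles cross because D, x and y satisfy the strict triangle inequalities.
    Their squares are what places the crossing abscissa \<open>u0\<close> strictly inside the
    shadows of both disks.\<close>
  have sq: "(D - x)\<^sup>2 < y\<^sup>2" "y\<^sup>2 < (D + x)\<^sup>2"
    using power_strict_mono[OF y(2), of 2] power_strict_mono[OF y(3), of 2] y by auto
  have "(x - y)\<^sup>2 < D\<^sup>2" "D\<^sup>2 < (x + y)\<^sup>2"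
    using y x D power_strict_mono[of "\<bar>x - y\<bar>" D 2] power_strict_mono[of D "x + y" 2] by auto
  note sq = sq this
  have u0: "x - D < u0" "u0 < x + D" "-y < u0" "u0 < y"
  proof -
    note d = sq[unfolded power2_eq_square ring_distribs]
    show "x - D < u0" "u0 < x + D" "-y < u0" "u0 < y"
      using d x unfolding u0_def
      by (simp_all only: pos_less_divide_eq pos_divide_less_eq mult_pos_pos zero_less_numeral)
        (simp_all add: power2_eq_square algebra_simps)
  qed
  \<comment> \<open>The line through the two crossing points is the radical axis. Both bounds agree
    there, so the formula of the right piece is valid at its left endpoint too.\<close>
  have eq0: "D\<^sup>2 - (u0 - x)\<^sup>2 = y\<^sup>2 - u0\<^sup>2"
    using x by (simp add: u0_def field_simps power2_eq_square)
  have cmp: "m u = (if u \<le> u0 then D\<^sup>2 - (u - x)\<^sup>2 else y\<^sup>2 - u\<^sup>2)" for u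
  proof -
    have "u \<le> u0 \<longleftrightarrow> D\<^sup>2 - (u - x)\<^sup>2 \<le> y\<^sup>2 - u\<^sup>2"
      using x by (simp add: u0_def field_simps power2_eq_square)
    then show ?thesis by (auto simp: m_def)
  qed
  have sec: "emeasure lborel {b. (a - x)\<^sup>2 + b\<^sup>2 \<le> D\<^sup>2 \<and> a\<^sup>2 + b\<^sup>2 \<le> y\<^sup>2} =
      ennreal (2 * sqrt (max 0 (m a)))" for a
  proof -
    have "{b. (a - x)\<^sup>2 + b\<^sup>2 \<le> D\<^sup>2 \<and> a\<^sup>2 + b\<^sup>2 \<le> y\<^sup>2} = {b. b\<^sup>2 \<le> m a}"
      by (auto simp: m_def)
    also have "\<dots> = (if 0 \<le> m a then {- sqrt (m a)..sqrt (m a)} else {})"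
    proof -
      have "b\<^sup>2 \<le> m a \<longleftrightarrow> \<bar>b\<bar> \<le> sqrt (m a)" if "0 \<le> m a" for b
        using that by (metis real_sqrt_abs real_sqrt_le_iff)
      moreover have "\<not> b\<^sup>2 \<le> m a" if "\<not> 0 \<le> m a" for b
        using that zero_le_power2[of b] by linarith
      ultimately show ?thesis
        by (auto simp: abs_le_iff)
    qed
    finally show ?thesis by auto
  qed
  define L where "L = ((u0 - x) * sqrt (D\<^sup>2 - (u0 - x)\<^sup>2) + D\<^sup>2 * arcsin ((u0 - x) / D)) -
     ((x - D - x) * sqrt (D\<^sup>2 - (x - D - x)\<^sup>2) + D\<^sup>2 * arcsin ((x - D - x) / D)) +
     (((y - 0) * sqrt (y\<^sup>2 - (y - 0)\<^sup>2) + y\<^sup>2 * arcsin ((y - 0) / y)) -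
     ((u0 - 0) * sqrt (y\<^sup>2 - (u0 - 0)\<^sup>2) + y\<^sup>2 * arcsin ((u0 - 0) / y)))"
  have I: "((\<lambda>u. 2 * sqrt (max 0 (m u))) has_integral L) {x - D..y}"
    unfolding L_def
  proof (rule has_integral_combine[where c = u0])
    have "0 \<le> D\<^sup>2 - (u - x)\<^sup>2" if "u \<in> {x - D..u0}" for u
      using that u0 power_mono[of "\<bar>u - x\<bar>" D 2] by auto
    then show "((\<lambda>u. 2 * sqrt (max 0 (m u))) has_integral
      ((u0 - x) * sqrt (D\<^sup>2 - (u0 - x)\<^sup>2) + D\<^sup>2 * arcsin ((u0 - x) / D)) -
     ((x - D - x) * sqrt (D\<^sup>2 - (x - D - x)\<^sup>2) + D\<^sup>2 * arcsin ((x - D - x) / D))) {x - D..u0}"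
      using u0 D by (intro has_integral_eq[OF _ has_integral_semicircle]) (auto simp: cmp max_def)
    have "0 \<le> y\<^sup>2 - (u - 0)\<^sup>2" if "u \<in> {u0..y}" for u
      using that u0 power_mono[of "\<bar>u\<bar>" y 2] by auto
    moreover have "m u = y\<^sup>2 - (u - 0)\<^sup>2" if "u \<in> {u0..y}" for u
      using that eq0 by (auto simp: cmp)
    ultimately show "((\<lambda>u. 2 * sqrt (max 0 (m u))) has_integral
       (((y - 0) * sqrt (y\<^sup>2 - (y - 0)\<^sup>2) + y\<^sup>2 * arcsin ((y - 0) / y)) -
     ((u0 - 0) * sqrt (y\<^sup>2 - (u0 - 0)\<^sup>2) + y\<^sup>2 * arcsin ((u0 - 0) / y)))) {u0..y}"
      using u0 y by (intro has_integral_eq[OF _ has_integral_semicircle]) (auto simp: max_def)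
  qed (use u0 in auto)
  have [measurable]: "{(a, b). (a - x)\<^sup>2 + b\<^sup>2 \<le> D\<^sup>2 \<and> a\<^sup>2 + b\<^sup>2 \<le> y\<^sup>2} \<in> sets (borel \<Otimes>\<^sub>M borel)"
  proof -
    have "{p \<in> space (borel \<Otimes>\<^sub>M borel). (fst p - x)\<^sup>2 + (snd p)\<^sup>2 \<le> D\<^sup>2 \<and> (fst p)\<^sup>2 + (snd p)\<^sup>2 \<le> y\<^sup>2}
        \<in> sets (borel \<Otimes>\<^sub>M borel)"
      by measurable
    moreover have "{p. (fst p - x)\<^sup>2 + (snd p)\<^sup>2 \<le> D\<^sup>2 \<and> (fst p)\<^sup>2 + (snd p)\<^sup>2 \<le> y\<^sup>2} =
        {(a, b). (a - x)\<^sup>2 + b\<^sup>2 \<le> D\<^sup>2 \<and> a\<^sup>2 + b\<^sup>2 \<le> y\<^sup>2}"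
      by auto
    ultimately show ?thesis
      by (simp add: space_pair_measure)
  qed
  have "emeasure lborel ?A = emeasure (lborel \<Otimes>\<^sub>M lborel)
      {(a, b). (a - x)\<^sup>2 + b\<^sup>2 \<le> D\<^sup>2 \<and> a\<^sup>2 + b\<^sup>2 \<le> y\<^sup>2}"
  proof -
    have "?A \<in> sets borel"
      by (intro sets.Int borel_closed closed_cball)
    then show ?thesis
      unfolding A by (subst lborel_real_2, subst emeasure_distr)
        (auto simp: space_pair_measure split_beta intro!: arg_cong2[where f = emeasure])
  qed
  also have "\<dots> = (\<integral>\<^sup>+a. emeasure lborel {b. (a - x)\<^sup>2 + b\<^sup>2 \<le> D\<^sup>2 \<and> a\<^sup>2 + b\<^sup>2 \<le> y\<^sup>2} \<partial>lborel)"
    by (subst lborel.emeasure_pair_measure_alt) (auto simp: vimage_def)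
  also have "\<dots> = (\<integral>\<^sup>+a. ennreal (2 * sqrt (max 0 (m a))) * indicator {x - D..y} a \<partial>lborel)"
  proof (intro nn_integral_cong)
    fix a
    \<comment> \<open>x - D is the leftmost abscissa of the shifted disk and y the rightmost one of
      the centered disk; beyond them one of the two disks has at most a single point in the
      section.\<close>
    have "m a \<le> 0" if "a \<notin> {x - D..y}"
    proof (cases "a \<le> u0")
      case True
      then have "D < \<bar>a - x\<bar>" using that u0 D by auto
      then show ?thesis using True D power_strict_mono[of D "\<bar>a - x\<bar>" 2] by (simp add: cmp)
    next
      case False
      then have "y < \<bar>a\<bar>" using that u0 y by auto
      then show ?thesis using False y power_strict_mono[of y "\<bar>a\<bar>" 2] by (simp add: cmp)
    qed
    then show "emeasure lborel {b. (a - x)\<^sup>2 + b\<^sup>2 \<le> D\<^sup>2 \<and> a\<^sup>2 + b\<^sup>2 \<le> y\<^sup>2} =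
        ennreal (2 * sqrt (max 0 (m a))) * indicator {x - D..y} a"
      unfolding sec by (auto simp: max_def indicator_def)
  qed
  also have "\<dots> = ennreal L"
    by (rule nn_integral_has_integral_lebesgue'[OF _ I]) auto
  finally have "emeasure lborel ?A = ennreal L" .
  moreover have "0 \<le> L"
    by (rule has_integral_nonneg[OF I]) auto
  ultimately have "measure lborel ?A = L"
    by (simp add: measure_def)
  also have "L = lens_area D x y"
  proof -
    have q: "\<bar>u0 / y\<bar> \<le> 1" "\<bar>(x - u0) / D\<bar> \<le> 1"
      using u0 y D by (auto simp: field_simps abs_le_iff)
    have e1: "(D\<^sup>2 + x\<^sup>2 - y\<^sup>2) / (2 * x * D) = (x - u0) / D" "(y\<^sup>2 + x\<^sup>2 - D\<^sup>2) / (2 * x * y) = u0 / y"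
      using x D y by (auto simp: u0_def field_simps power2_eq_square)
    \<comment> \<open>Heron's formula: both sides are 16 times the squared area of the triangle with
      sides D, x, y, which has base x and height sqrt (y^2 - u0^2).\<close>
    have "(((y + x)\<^sup>2 - D\<^sup>2) * (D\<^sup>2 - (y - x)\<^sup>2)) = (2 * x)\<^sup>2 * (y\<^sup>2 - u0\<^sup>2)"
      using x by (simp add: u0_def field_simps power2_eq_square)
    then have e2: "1 / 2 * sqrt (((y + x)\<^sup>2 - D\<^sup>2) * (D\<^sup>2 - (y - x)\<^sup>2)) = x * sqrt (y\<^sup>2 - u0\<^sup>2)"
      using x by (simp add: real_sqrt_mult)
    have ac: "arccos z = pi / 2 - arcsin z" if "\<bar>z\<bar> \<le> 1" for z
      using that by (intro arccos_arcsin_eq) (auto simp: abs_le_iff)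
    have "(x - D - x) / D = -1"
      using D by simp
    then have "L = (u0 - x) * sqrt (y\<^sup>2 - u0\<^sup>2) + D\<^sup>2 * (arcsin ((u0 - x) / D) + pi / 2)
       + y\<^sup>2 * (pi / 2 - arcsin (u0 / y)) - u0 * sqrt (y\<^sup>2 - u0\<^sup>2)"
      using y D unfolding L_def eq0 by (simp add: algebra_simps)
    also have "arcsin ((u0 - x) / D) = - arcsin ((x - u0) / D)"
      using arcsin_minus[of "(x - u0) / D"] q(2)[unfolded abs_le_iff]
      by (metis minus_diff_eq minus_divide_left minus_le_iff)
    finally show ?thesis
      unfolding lens_area_def e1 e2 ac[OF q(1)] ac[OF q(2)] by (simp add: algebra_simps)
  qed
  finally show ?thesis .
qed

section \<open>The overlap area as the unnormalised distribution function of the distance, for every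
  radius\<close>

definition disk_overlap :: "real ^ 2 \<Rightarrow> real \<Rightarrow> real \<Rightarrow> real" where
  "disk_overlap xo D y = measure lborel (cball xo D \<inter> cball 0 y)"

lemma content_cball_2:
  "0 \<le> r \<Longrightarrow> measure lborel (cball c r :: (real ^ 2) set) = pi * r\<^sup>2"
  by (simp add: content_cball unit_ball_vol_2)

lemma disk_overlap_inner:
  assumes "0 \<le> y" "y \<le> D - norm xo"
  shows "disk_overlap xo D y = pi * y\<^sup>2"
proof -
  have "cball 0 y \<subseteq> cball xo D"
    using assms norm_triangle_ineq4[of _ xo] norm_triangle_sub[of _ xo]
    by (auto simp: dist_norm norm_minus_commute) (smt (verit, best))
  then have "cball xo D \<inter> cball 0 y = cball 0 y"
    by blast
  then show ?thesis
    using assms by (simp add: disk_overlap_def content_cball_2)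
qed

lemma disk_overlap_outer:
  assumes "0 \<le> D" "D + norm xo \<le> y"
  shows "disk_overlap xo D y = pi * D\<^sup>2"
proof -
  have "cball xo D \<subseteq> cball 0 y"
    using assms norm_triangle_ineq4[of _ xo] norm_triangle_sub[of _ xo]
    by (auto simp: dist_norm norm_minus_commute) (smt (verit, best))
  then have "cball xo D \<inter> cball 0 y = cball xo D"
    by blast
  then show ?thesis
    using assms by (simp add: disk_overlap_def content_cball_2)
qed

lemma norm_axis: "norm (axis i a :: real ^ 'n) = \<bar>a\<bar>"
proof -
  have "axis i a = a *\<^sub>R (axis i 1 :: real ^ 'n)"
    by (simp add: axis_def vec_eq_iff)
  then show ?thesis by (metis norm_axis_1 norm_scaleR mult_1_right)
qed

text \<open>A rotation moves the center to the first axis without changing the area. The bounds on y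
  force \<open>norm xo\<close> and y to be positive.\<close>

lemma disk_overlap_lens:
  assumes D: "0 < D" "norm xo \<le> D" and y: "D - norm xo < y" "y < D + norm xo"
  shows "disk_overlap xo D y = lens_area D (norm xo) y"
proof -
  obtain f :: "real ^ 2 \<Rightarrow> real ^ 2" where f: "orthogonal_transformation f" "f (axis 1 (norm xo)) = xo"
    by (rule orthogonal_transformation_exists[of "axis 1 (norm xo)" xo]) (auto simp: norm_axis)
  let ?A = "cball (axis 1 (norm xo)) D \<inter> cball 0 y :: (real ^ 2) set"
  have "f 0 = 0"
    using f(1) by (simp add: linear_0 orthogonal_transformation_linear)
  moreover have "inj f"
    using f(1) by (rule orthogonal_transformation_inj)
  ultimately have im: "f ` ?A = cball xo D \<inter> cball 0 y"
    using f by (simp add: image_Int image_orthogonal_transformation_cball)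
  have [measurable]: "?A \<in> sets borel" "cball xo D \<inter> cball 0 y \<in> sets borel"
    by (intro sets.Int borel_closed closed_cball)+
  have "measure lborel (f ` ?A) = measure lborel ?A"
    by (rule measure_orthogonal_image_2[OF f(1)]) (auto simp: im)
  also have "\<dots> = lens_area D (norm xo) y"
    using assms by (intro measure_disk_inter_eq_lens_area) auto
  finally show ?thesis
    by (simp add: disk_overlap_def im)
qed

lemma fmeasurable_disk_overlap: "cball xo D \<inter> cball (0 :: real ^ 2) y \<in> fmeasurable lborel"
  by (intro fmeasurable_compact compact_Int compact_cball)

lemma mono_disk_overlap: "mono (disk_overlap xo D)"
  unfolding disk_overlap_def
  by (intro monoI measure_mono_fmeasurable fmeasurable_disk_overlap fmeasurableD) auto

text \<open>The increment is the area of a part of an annulus. The bound yields continuity also at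
  the radii where the formula for the overlap changes, as the fundamental theorem with exceptional
  points requires.\<close>

lemma disk_overlap_diff_le:
  assumes "0 \<le> a" "a \<le> b"
  shows "\<bar>disk_overlap xo D b - disk_overlap xo D a\<bar> \<le> pi * b\<^sup>2 - pi * a\<^sup>2"
proof -
  let ?C = "\<lambda>y. cball xo D \<inter> cball (0 :: real ^ 2) y"
  have "disk_overlap xo D b - disk_overlap xo D a = measure lborel (?C b - ?C a)"
    unfolding disk_overlap_def using assms
    by (subst measurable_measure_Diff) (auto intro: fmeasurable_disk_overlap fmeasurableD)
  also have "\<dots> \<le> measure lborel (cball (0 :: real ^ 2) b - cball 0 a)"
    using fmeasurable_disk_overlap[THEN fmeasurableD]
    by (intro measure_mono_fmeasurable fmeasurable.Diff fmeasurable_compact compact_cball) auto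
  also have "\<dots> = pi * b\<^sup>2 - pi * a\<^sup>2"
    using assms by (subst measurable_measure_Diff) (auto simp: content_cball_2 intro: fmeasurable_compact)
  finally show ?thesis
    using monoD[OF mono_disk_overlap \<open>a \<le> b\<close>, of xo D] by simp
qed

lemma continuous_on_disk_overlap: "continuous_on {0..} (disk_overlap xo D)"
proof (unfold continuous_on_def, intro ballI)
  fix a :: real assume a: "a \<in> {0..}"
  show "(disk_overlap xo D \<longlongrightarrow> disk_overlap xo D a) (at a within {0..})"
  proof (rule LIM_zero_cancel, rule Lim_null_comparison)
    have "\<bar>disk_overlap xo D b - disk_overlap xo D a\<bar> \<le> \<bar>pi * b\<^sup>2 - pi * a\<^sup>2\<bar>" if "b \<in> {0..}" for b
      using disk_overlap_diff_le[of a b xo D] disk_overlap_diff_le[of b a xo D] that a by (cases "a \<le> b") auto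
    then show "\<forall>\<^sub>F b in at a within {0..}. norm (disk_overlap xo D b - disk_overlap xo D a) \<le> \<bar>pi * b\<^sup>2 - pi * a\<^sup>2\<bar>"
      by (auto simp: eventually_at_filter)
    show "((\<lambda>b. \<bar>pi * b\<^sup>2 - pi * a\<^sup>2\<bar>) \<longlongrightarrow> 0) (at a within {0..})"
      by (auto intro!: tendsto_eq_intros)
  qed
qed

section \<open>Differentiating the overlap area, and the radial density\<close>

lemma lens_area_differentiable:
  assumes D: "0 < D" and x: "0 < x" "x \<le> D" and y: "D - x < y" "y < D + x"
  shows "\<exists>d. (lens_area D x has_real_derivative d) (at y)"
proof -
  have sq: "(D - x)\<^sup>2 < y\<^sup>2" "y\<^sup>2 < (D + x)\<^sup>2" "(y - x)\<^sup>2 < D\<^sup>2" "D\<^sup>2 < (y + x)\<^sup>2"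
    using power_strict_mono[of "D - x" y 2] power_strict_mono[of y "D + x" 2]
      power_strict_mono[of "\<bar>y - x\<bar>" D 2] power_strict_mono[of D "y + x" 2] assms by auto
  have "0 < y" using assms by simp
  \<comment> \<open>A positive radicand here and arccosine arguments strictly between -1 and 1 below
    are all that differentiability needs. Only the existence of a derivative matters, since
    \<open>dist_density\<close> is stated with \<open>deriv\<close>.\<close>
  have s: "0 < ((y + x)\<^sup>2 - D\<^sup>2) * (D\<^sup>2 - (y - x)\<^sup>2)"
    using sq by simp
  have a: "-1 < (D\<^sup>2 + x\<^sup>2 - y\<^sup>2) / (2 * x * D)" "(D\<^sup>2 + x\<^sup>2 - y\<^sup>2) / (2 * x * D) < 1"
    "-1 < (y\<^sup>2 + x\<^sup>2 - D\<^sup>2) / (2 * x * y)" "(y\<^sup>2 + x\<^sup>2 - D\<^sup>2) / (2 * x * y) < 1"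
  proof -
    note d = sq[unfolded power2_eq_square ring_distribs]
    show "-1 < (D\<^sup>2 + x\<^sup>2 - y\<^sup>2) / (2 * x * D)" "(D\<^sup>2 + x\<^sup>2 - y\<^sup>2) / (2 * x * D) < 1"
    "-1 < (y\<^sup>2 + x\<^sup>2 - D\<^sup>2) / (2 * x * y)" "(y\<^sup>2 + x\<^sup>2 - D\<^sup>2) / (2 * x * y) < 1"
      using d x D \<open>0 < y\<close>
      by (simp_all only: pos_less_divide_eq pos_divide_less_eq mult_pos_pos zero_less_numeral)
        (simp_all add: power2_eq_square algebra_simps)
  qed
  have "\<exists>d. ((\<lambda>y. sqrt (((y + x)\<^sup>2 - D\<^sup>2) * (D\<^sup>2 - (y - x)\<^sup>2))) has_real_derivative d) (at y)"
    by (rule exI, rule DERIV_chain2[where f = sqrt and g = "\<lambda>y. ((y + x)\<^sup>2 - D\<^sup>2) * (D\<^sup>2 - (y - x)\<^sup>2)", OF DERIV_real_sqrt[OF s]]) (rule derivative_eq_intros refl)+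
  then obtain d where d: "((\<lambda>y. sqrt (((y + x)\<^sup>2 - D\<^sup>2) * (D\<^sup>2 - (y - x)\<^sup>2))) has_real_derivative d) (at y)"
    by blast
  show ?thesis
    unfolding lens_area_def
    by (rule exI) (rule d derivative_eq_intros derivative_eq_intros refl | use a s x D \<open>0 < y\<close> in \<open>simp; fail\<close>)+
qed

lemma disk_overlap_deriv:
  fixes xo :: "real ^ 2"
  assumes D: "0 < D" "norm xo \<le> D" and y: "D - norm xo < y" "y < D + norm xo"
  shows "(disk_overlap xo D has_real_derivative deriv (lens_area D (norm xo)) y) (at y)"
proof -
  have "0 < norm xo" using y by linarith
  then obtain d where d: "(lens_area D (norm xo) has_real_derivative d) (at y)"
    using lens_area_differentiable[OF D(1) _ D(2) y] by blast
  then have "(disk_overlap xo D has_real_derivative d) (at y)"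
    by (rule has_field_derivative_transform_within_open[where S = "{D - norm xo<..<D + norm xo}"])
       (use assms in \<open>auto simp: disk_overlap_lens\<close>)
  with d show ?thesis
    by (simp add: DERIV_imp_deriv)
qed

text \<open>At the point \<open>D - x\<close>, where the lens area need not be differentiable, \<^const>\<open>dist_density\<close> is a
  junk value of \<^const>\<open>deriv\<close>.\<close>

definition radial_density :: "real \<Rightarrow> real \<Rightarrow> real \<Rightarrow> real" where
  "radial_density D x y = (if y = D - x then 0 else dist_density D x y)"

lemma AE_dist_density: "AE y in lborel. dist_density D x y = radial_density D x y"
  using AE_lborel_singleton[of "D - x"] by eventually_elim (simp add: radial_density_def)

lemma disk_overlap_radial_density:
  fixes xo :: "real ^ 2"
  assumes D: "0 < D" "norm xo \<le> D" and y: "0 < y" "y \<noteq> D - norm xo" "y \<noteq> D + norm xo"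
  shows "(disk_overlap xo D has_real_derivative pi * D\<^sup>2 * radial_density D (norm xo) y) (at y)"
proof -
  let ?x = "norm xo"
  consider "y < D - ?x" | "D - ?x < y" "y < D + ?x" | "D + ?x < y"
    using y by linarith
  then show ?thesis
  proof cases
    case 1
    have "((\<lambda>y. pi * y\<^sup>2) has_real_derivative pi * D\<^sup>2 * radial_density D ?x y) (at y)"
      using 1 y D by (auto intro!: derivative_eq_intros simp: radial_density_def dist_density_def)
    then show ?thesis
      by (rule has_field_derivative_transform_within_open[where S = "{0<..<D - ?x}"])
        (use 1 y in \<open>auto simp: disk_overlap_inner\<close>)
  next
    case 2
    have "radial_density D ?x y = deriv (lens_area D ?x) y / (pi * D\<^sup>2)"
      using 2 y D by (auto simp: radial_density_def dist_density_def)
    then show ?thesis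
      using disk_overlap_deriv[OF D 2] D by simp
  next
    case 3
    have "((\<lambda>y. pi * D\<^sup>2) has_real_derivative pi * D\<^sup>2 * radial_density D ?x y) (at y)"
      using 3 y D norm_ge_zero[of xo] by (auto intro!: derivative_eq_intros simp: radial_density_def dist_density_def simp del: norm_ge_zero)
    then show ?thesis
      by (rule has_field_derivative_transform_within_open[where S = "{D + ?x<..}"])
        (use 3 D in \<open>auto simp: disk_overlap_outer\<close>)
  qed
qed

lemma radial_density_eq_0:
  "0 < D \<Longrightarrow> 0 \<le> x \<Longrightarrow> x \<le> D \<Longrightarrow> y < 0 \<or> D + x \<le> y \<Longrightarrow> radial_density D x y = 0"
  by (auto simp: radial_density_def dist_density_def)

text \<open>No sign can be read off a \<open>deriv\<close> term; it comes from the monotonicity of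
  the overlap area.\<close>

lemma radial_density_nonneg:
  fixes xo :: "real ^ 2"
  assumes D: "0 < D" "norm xo \<le> D"
  shows "0 \<le> radial_density D (norm xo) y"
proof -
  consider "y < 0 \<or> D + norm xo \<le> y" | "y = 0" "y < D - norm xo" | "y = D - norm xo" |
    "0 < y" "y \<noteq> D - norm xo" "y \<noteq> D + norm xo"
    using D by linarith
  then show ?thesis
  proof cases
    case 4
    have "0 \<le> pi * D\<^sup>2 * radial_density D (norm xo) y"
      using mono_on_imp_deriv_nonneg[of UNIV, OF mono_disk_overlap disk_overlap_radial_density[OF D 4]] by simp
    then show ?thesis
      using D mult_le_cancel_left_pos[of "pi * D\<^sup>2" 0] by simp
  next
    case 1
    then show ?thesis using D by (simp add: radial_density_eq_0)
  qed (use D in \<open>auto simp: radial_density_def dist_density_def\<close>)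
qed

text \<open>Off the exceptional radii the density is a pointwise limit of difference quotients of
  the monotone, hence Borel, overlap area. The remaining values are patched in by hand.\<close>

lemma radial_density_measurable [measurable]:
  fixes xo :: "real ^ 2"
  assumes D: "0 < D" "norm xo \<le> D"
  shows "radial_density D (norm xo) \<in> borel_measurable borel"
proof -
  let ?x = "norm xo"
  let ?F = "disk_overlap xo D"
  have [measurable]: "?F \<in> borel_measurable borel"
    using borel_measurable_mono[OF mono_disk_overlap] .
  define I where "I = {0<..} - {D - ?x, D + ?x}"
  have [measurable]: "I \<in> sets borel" unfolding I_def by measurable
  have M: "(\<lambda>y. indicator I y * radial_density D ?x y) \<in> borel_measurable borel"
  proof (rule borel_measurable_LIMSEQ_real)
    fix y :: real
    show "(\<lambda>n. indicator I y * ((?F (y + inverse (Suc n)) - ?F y) / inverse (Suc n)) / (pi * D\<^sup>2)) \<longlonglongrightarrow> indicator I y * radial_density D ?x y"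
    proof (cases "y \<in> I")
      case True
      then have "(\<lambda>h. (?F (y + h) - ?F y) / h) \<midarrow>0\<rightarrow> pi * D\<^sup>2 * radial_density D ?x y"
        using disk_overlap_radial_density[OF D, of y] by (auto simp: I_def DERIV_def)
      moreover have "filterlim (\<lambda>n. inverse (real (Suc n))) (at 0) sequentially"
        by (auto simp: filterlim_at intro!: LIMSEQ_inverse_real_of_nat simp del: of_nat_Suc)
      ultimately have "(\<lambda>n. (?F (y + inverse (Suc n)) - ?F y) / inverse (Suc n)) \<longlonglongrightarrow> pi * D\<^sup>2 * radial_density D ?x y"
        by (rule filterlim_compose)
      then have "(\<lambda>n. (?F (y + inverse (Suc n)) - ?F y) / inverse (Suc n) / (pi * D\<^sup>2)) \<longlonglongrightarrow> pi * D\<^sup>2 * radial_density D ?x y / (pi * D\<^sup>2)"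
        using D by (intro tendsto_divide tendsto_const) auto
      then show ?thesis using True D by simp
    qed simp
  qed measurable
  have "radial_density D ?x y = indicator I y * radial_density D ?x y + (if y = 0 then radial_density D ?x 0 else 0)" for y
  proof -
    consider "y \<in> I" | "y < 0 \<or> D + ?x \<le> y" | "y = 0" | "y = D - ?x"
      unfolding I_def by force
    then show ?thesis
    proof cases
      case 4
      then show ?thesis by (simp add: radial_density_def)
    qed (use D in \<open>auto simp: I_def indicator_def radial_density_eq_0\<close>)
  qed
  then have eq: "radial_density D ?x = (\<lambda>y. indicator I y * radial_density D ?x y + (if y = 0 then radial_density D ?x 0 else 0))"
    by (rule ext)
  have "(\<lambda>y::real. if y = 0 then radial_density D ?x 0 else 0) \<in> borel_measurable borel"
    by measurable
  with M show ?thesis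
    by (subst eq) (rule borel_measurable_add)
qed

text \<open>The overlap area is continuous, vanishes at radius 0 and has the scaled density as
  derivative except at the two radii where a circle becomes tangent, so the fundamental theorem with
  a finite exceptional set applies.\<close>

lemma nn_integral_radial_density:
  fixes xo :: "real ^ 2"
  assumes D: "0 < D" "norm xo \<le> D" and t: "0 \<le> t"
  shows "(\<integral>\<^sup>+y. ennreal (radial_density D (norm xo) y) * indicator {..t} y \<partial>lborel) =
    ennreal (disk_overlap xo D t / (pi * D\<^sup>2))"
proof -
  have "((\<lambda>y. pi * D\<^sup>2 * radial_density D (norm xo) y) has_integral (disk_overlap xo D t - disk_overlap xo D 0)) {0..t}"
    using t continuous_on_subset[OF continuous_on_disk_overlap, of "{0..t}"]
    by (intro fundamental_theorem_of_calculus_interior_strong[where S = "{D - norm xo, D + norm xo}"])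
      (auto intro!: disk_overlap_radial_density[OF D] simp flip: has_real_derivative_iff_has_vector_derivative)
  from has_integral_mult_right[OF this, of "1 / (pi * D\<^sup>2)"]
  have "(radial_density D (norm xo) has_integral disk_overlap xo D t / (pi * D\<^sup>2)) {0..t}"
    using D by (simp add: disk_overlap_inner)
  then have "(\<integral>\<^sup>+y. ennreal (radial_density D (norm xo) y) * indicator {0..t} y \<partial>lborel) =
      ennreal (disk_overlap xo D t / (pi * D\<^sup>2))"
    by (rule nn_integral_has_integral_lebesgue'[rotated]) (rule radial_density_nonneg[OF D])
  then show ?thesis
    using D by (subst (asm) nn_integral_cong[where v = "\<lambda>y. ennreal (radial_density D (norm xo) y) * indicator {..t} y"])
      (auto simp: indicator_def radial_density_eq_0)
qed

text \<open>This justifies the density of the statement: both laws have the distribution function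
  \<open>disk_overlap xo D t / (pi * D^2)\<close> for t at least 0, and 0 below.\<close>

lemma distr_norm_uniform_disk:
  fixes xo :: "real ^ 2"
  assumes D: "0 < D" "norm xo \<le> D"
  shows "distr (uniform_measure lborel (cball xo D)) borel norm =
    density lborel (radial_density D (norm xo))"
proof (rule cdf_unique)
  note [measurable] = radial_density_measurable[OF D]
  have [measurable]: "cball xo D \<in> sets borel" by (intro borel_closed closed_cball)
  have A: "emeasure lborel (cball xo D) = ennreal (pi * D\<^sup>2)"
    using D by (simp add: emeasure_cball unit_ball_vol_2)
  interpret U: prob_space "uniform_measure lborel (cball xo D)"
    using A D by (intro prob_space_uniform_measure) auto
  show "real_distribution (distr (uniform_measure lborel (cball xo D)) borel norm)"
    by (intro real_distribution.intro U.prob_space_distr real_distribution_axioms.intro) auto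
  \<comment> \<open>Total mass one: the ball of radius \<open>D + norm xo\<close> around the origin
    contains the whole disk.\<close>
  have "(\<integral>\<^sup>+y. ennreal (radial_density D (norm xo) y) \<partial>lborel) =
      (\<integral>\<^sup>+y. ennreal (radial_density D (norm xo) y) * indicator {..D + norm xo} y \<partial>lborel)"
    using D by (intro nn_integral_cong) (auto simp: indicator_def radial_density_eq_0)
  also have "\<dots> = 1"
    using D by (subst nn_integral_radial_density[OF D]) (auto simp: disk_overlap_outer)
  finally show "real_distribution (density lborel (radial_density D (norm xo)))"
    by (intro real_distribution.intro prob_spaceI real_distribution_axioms.intro) (auto simp: emeasure_density)
  show "cdf (distr (uniform_measure lborel (cball xo D)) borel norm) =
      cdf (density lborel (radial_density D (norm xo)))"
  proof
    fix t :: real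
    have "emeasure (distr (uniform_measure lborel (cball xo D)) borel norm) {..t} =
        emeasure lborel (cball xo D \<inter> cball 0 t) / ennreal (pi * D\<^sup>2)"
    proof -
      have "norm -` {..t} = (cball 0 t :: (real ^ 2) set)" by auto
      moreover have "cball (0 :: real ^ 2) t \<in> sets borel" by (intro borel_closed closed_cball)
      ultimately show ?thesis
        by (simp add: emeasure_distr A)
    qed
    also have "\<dots> = ennreal (disk_overlap xo D t) / ennreal (pi * D\<^sup>2)"
      unfolding disk_overlap_def using fmeasurable_disk_overlap[of xo D t]
      by (subst emeasure_eq_measure2) (auto simp: fmeasurable_def)
    also have "\<dots> = ennreal (disk_overlap xo D t / (pi * D\<^sup>2))"
      using D by (intro divide_ennreal) (auto simp: disk_overlap_def)
    finally have "cdf (distr (uniform_measure lborel (cball xo D)) borel norm) t = disk_overlap xo D t / (pi * D\<^sup>2)"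
      by (simp add: cdf_def measure_def disk_overlap_def)
    moreover have "cdf (density lborel (radial_density D (norm xo))) t = disk_overlap xo D t / (pi * D\<^sup>2)"
    proof (cases "0 \<le> t")
      case True
      then show ?thesis
        using nn_integral_radial_density[OF D, of t]
        by (simp add: cdf_def measure_def emeasure_density disk_overlap_def)
    next
      case False
      then have "(\<integral>\<^sup>+y. ennreal (radial_density D (norm xo) y) * indicator {..t} y \<partial>lborel) = (\<integral>\<^sup>+(y::real). 0 \<partial>lborel)"
        using D by (intro nn_integral_cong) (auto simp: indicator_def radial_density_eq_0)
      then show ?thesis
        using False by (simp add: cdf_def measure_def emeasure_density disk_overlap_def)
    qed
    ultimately show "cdf (distr (uniform_measure lborel (cball xo D)) borel norm) t =
      cdf (density lborel (radial_density D (norm xo))) t" by simp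
  qed
qed

section \<open>Symmetric products over a Poisson point process\<close>

text \<open>Zeros of a nontrivial power series are isolated. Vanishing is assumed only on [0, 1]
  because h with values in [0, 1] can be scaled only by such z without leaving the range where the
  generating functional is available.\<close>

lemma powser_coeffs_eq_0:
  fixes d :: "nat \<Rightarrow> real"
  assumes s1: "summable (\<lambda>n. \<bar>d n\<bar>)" and z: "\<And>z. 0 \<le> z \<Longrightarrow> z \<le> 1 \<Longrightarrow> (\<Sum>n. d n * z ^ n) = 0"
  shows "d m = 0"
proof (rule ccontr)
  assume dm: "d m \<noteq> 0"
  define f where "f x = (\<Sum>n. d n * x ^ n)" for x
  have sums: "(\<lambda>n. d n * x ^ n) sums f x" if "\<bar>x\<bar> < 1" for x
    unfolding f_def
  proof (intro summable_sums summable_comparison_test[OF _ s1] exI allI impI)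
    fix n show "norm (d n * x ^ n) \<le> \<bar>d n\<bar>"
      using that by (simp add: abs_mult power_abs mult_left_le power_le_one)
  qed
  have f0: "f x = 0" if "0 \<le> x" "x \<le> 1" for x
    using z that by (simp add: f_def)
  have "d 0 = 0"
    using f0[of 0] by (simp add: f_def)
  then have "m > 0" using dm by (cases m) auto
  obtain s where "0 < s" "\<And>x. x \<in> cball 0 s - {0} \<Longrightarrow> f x \<noteq> 0"
  proof (rule powser_0_nonzero[of 1 0 d f m])
    show "(\<lambda>n. d n * (x - 0) ^ n) sums f x" if "norm (x - 0) < 1" for x
      using that sums[of x] by simp
  qed (use dm \<open>m > 0\<close> f0[of 0] in auto)
  \<comment> \<open>A nonzero point that lies both in the zero-free punctured ball and in
    [0, 1].\<close>
  moreover have "min s 1 \<in> cball 0 s - {0}"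
    using \<open>0 < s\<close> by (auto simp: min_def)
  ultimately show False
    using f0[of "min s 1"] \<open>0 < s\<close> by simp
qed

lemma (in prob_space) sums_integral_nat_partition:
  fixes f :: "'a \<Rightarrow> real" and X :: "'a \<Rightarrow> nat"
  assumes [measurable]: "X \<in> M \<rightarrow>\<^sub>M count_space UNIV" and f: "integrable M f" "\<And>\<omega>. 0 \<le> f \<omega>"
  shows "(\<lambda>n. \<integral>\<omega>. f \<omega> * indicator {\<omega> \<in> space M. X \<omega> = n} \<omega> \<partial>M) sums (\<integral>\<omega>. f \<omega> \<partial>M)"
proof -
  have [measurable]: "f \<in> borel_measurable M" using f by simp
  have int: "integrable M (\<lambda>\<omega>. f \<omega> * indicator {\<omega> \<in> space M. X \<omega> = n} \<omega>)" for n
    using f by (intro integrable_real_mult_indicator) auto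
  have "ennreal (\<integral>\<omega>. f \<omega> \<partial>M) = (\<integral>\<^sup>+\<omega>. f \<omega> \<partial>M)"
    using f by (simp add: nn_integral_eq_integral)
  also have "\<dots> = (\<integral>\<^sup>+\<omega>. (\<Sum>n. ennreal (f \<omega> * indicator {\<omega> \<in> space M. X \<omega> = n} \<omega>)) \<partial>M)"
  proof (intro nn_integral_cong)
    fix \<omega> assume "\<omega> \<in> space M"
    then have "(\<lambda>n. ennreal (f \<omega> * indicator {\<omega> \<in> space M. X \<omega> = n} \<omega>)) = (\<lambda>n. if n = X \<omega> then ennreal (f \<omega>) else 0)"
      by (auto simp: indicator_def)
    then show "ennreal (f \<omega>) = (\<Sum>n. ennreal (f \<omega> * indicator {\<omega> \<in> space M. X \<omega> = n} \<omega>))"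
      using sums_unique[OF sums_single[of "X \<omega>" "\<lambda>_. ennreal (f \<omega>)"]] by simp
  qed
  also have "\<dots> = (\<Sum>n. \<integral>\<^sup>+\<omega>. ennreal (f \<omega> * indicator {\<omega> \<in> space M. X \<omega> = n} \<omega>) \<partial>M)"
    by (intro nn_integral_suminf) measurable
  also have "\<dots> = (\<Sum>n. ennreal (\<integral>\<omega>. f \<omega> * indicator {\<omega> \<in> space M. X \<omega> = n} \<omega> \<partial>M))"
    using f int by (intro suminf_cong nn_integral_eq_integral) auto
  finally have "(\<lambda>n. ennreal (\<integral>\<omega>. f \<omega> * indicator {\<omega> \<in> space M. X \<omega> = n} \<omega> \<partial>M)) sums ennreal (\<integral>\<omega>. f \<omega> \<partial>M)"
    using summable_sums[OF summableI] by simp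
  moreover have "0 \<le> (\<integral>\<omega>. f \<omega> * indicator {\<omega> \<in> space M. X \<omega> = n} \<omega> \<partial>M)" "0 \<le> (\<integral>\<omega>. f \<omega> \<partial>M)" for n
    using f by (auto intro!: integral_nonneg_AE)
  ultimately show ?thesis
    by (subst (asm) sums_ennreal)
qed

lemma (in prob_space) poisson_pgf:
  fixes X :: "'a \<Rightarrow> nat"
  assumes [measurable]: "X \<in> M \<rightarrow>\<^sub>M count_space UNIV"
    and X: "\<And>k. measure M {\<omega>\<in>space M. X \<omega> = k} = exp (- r) * r ^ k / fact k"
    and w: "0 \<le> w" "w \<le> 1"
  shows "(\<integral>\<omega>. w ^ X \<omega> \<partial>M) = exp (r * (w - 1))"
proof -
  have "(\<lambda>n. \<integral>\<omega>. w ^ X \<omega> * indicator {\<omega> \<in> space M. X \<omega> = n} \<omega> \<partial>M) sums (\<integral>\<omega>. w ^ X \<omega> \<partial>M)"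
    using w by (intro sums_integral_nat_partition integrable_const_bound[where B = 1])
      (auto simp: power_le_one)
  moreover have "(\<integral>\<omega>. w ^ X \<omega> * indicator {\<omega> \<in> space M. X \<omega> = n} \<omega> \<partial>M) = exp (- r) * ((r * w) ^ n /\<^sub>R fact n)" for n
  proof -
    have "(\<integral>\<omega>. w ^ X \<omega> * indicator {\<omega> \<in> space M. X \<omega> = n} \<omega> \<partial>M) = (\<integral>\<omega>. w ^ n * indicator {\<omega> \<in> space M. X \<omega> = n} \<omega> \<partial>M)"
      by (intro Bochner_Integration.integral_cong) (auto simp: indicator_def)
    then show ?thesis
      by (simp add: X Int_absorb1 power_mult_distrib divide_inverse mult_ac)
  qed
  ultimately have "(\<lambda>n. exp (- r) * ((r * w) ^ n /\<^sub>R fact n)) sums (\<integral>\<omega>. w ^ X \<omega> \<partial>M)"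
    by simp
  moreover have "(\<lambda>n. exp (- r) * ((r * w) ^ n /\<^sub>R fact n)) sums (exp (- r) * exp (r * w))"
    by (intro sums_mult exp_converges)
  ultimately show ?thesis
    by (simp add: sums_iff flip: exp_add) (simp add: algebra_simps)
qed

section \<open>The generating functional of an enumerated Poisson process\<close>

locale ppp_on =
  prob_space S for S :: "'w measure" +
  fixes lam :: real and W :: "'a::euclidean_space set" and num :: "'w \<Rightarrow> nat" and loc :: "nat \<Rightarrow> 'w \<Rightarrow> 'a"
  assumes ppp: "homogeneous_ppp S lam W (points num loc)"
    and inj: "AE \<omega> in S. inj_on (\<lambda>j. loc j \<omega>) {..<num \<omega>}"
    and num_meas [measurable]: "num \<in> S \<rightarrow>\<^sub>M count_space UNIV"
    and loc_meas [measurable]: "\<And>j. loc j \<in> S \<rightarrow>\<^sub>M borel"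
    and W [measurable]: "W \<in> sets borel" "bounded W"
begin

lemma prod_loc_measurable [measurable]:
  assumes [measurable]: "h \<in> borel_measurable borel"
  shows "(\<lambda>\<omega>. \<Prod>j<num \<omega>. h (loc j \<omega>) :: real) \<in> borel_measurable S"
  by (rule measurable_compose_countable[where f = "\<lambda>n \<omega>. \<Prod>j<n. h (loc j \<omega>)"]) measurable

lemma W_finite: "emeasure lborel (A \<inter> W) < \<infinity>"
  using emeasure_bounded_finite[of "A \<inter> W"] W(2) by (metis bounded_Int)

text \<open>For a function with finitely many values the product over the points is a product of
  powers \<open>w k ^ N_k\<close>, with N_k the number of points in the level set
  \<open>B k\<close>. The level sets are disjoint, so these counts are independent Poisson variables
  and the expectation factorizes.\<close>

lemma pgf_step:
  fixes \<kappa> :: "'a \<Rightarrow> nat" and w :: "nat \<Rightarrow> real"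
  assumes [measurable]: "\<kappa> \<in> borel \<rightarrow>\<^sub>M count_space UNIV" and \<kappa>: "\<And>v. \<kappa> v \<le> N"
    and w: "\<And>k. k \<le> N \<Longrightarrow> 0 \<le> w k" "\<And>k. k \<le> N \<Longrightarrow> w k \<le> 1"
  shows "(\<integral>\<omega>. (\<Prod>j<num \<omega>. w (\<kappa> (loc j \<omega>))) \<partial>S) = exp (lam * (\<integral>v. indicator W v * (w (\<kappa> v) - 1) \<partial>lborel))"
proof -
  define B where "B k = \<kappa> -` {k} \<inter> W" for k
  have [measurable]: "B k \<in> sets borel" for k
    unfolding B_def using measurable_sets[of \<kappa> borel "count_space UNIV" "{k}"] by simp
  have bB: "bounded (B k)" for k
    unfolding B_def using W(2) by (metis bounded_Int)
  note P1 = ppp[unfolded homogeneous_ppp_def, THEN conjunct1]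
  note P2 = ppp[unfolded homogeneous_ppp_def, THEN conjunct2, THEN conjunct1, rule_format, OF _ bB]
  note P3 = ppp[unfolded homogeneous_ppp_def, THEN conjunct2, THEN conjunct2, rule_format]
  have cm [measurable]: "(\<lambda>\<omega>. card (points num loc \<omega> \<inter> B k)) \<in> S \<rightarrow>\<^sub>M count_space UNIV" for k
    by (rule P2[THEN conjunct1]) simp
  have cP: "measure S {\<omega>\<in>space S. card (points num loc \<omega> \<inter> B k) = i} =
       exp (- (lam * measure lborel (B k))) * (lam * measure lborel (B k)) ^ i / fact i" for k i
  proof -
    have "B k \<inter> W = B k" by (auto simp: B_def)
    then show ?thesis using P2[THEN conjunct2, rule_format, of k i] by simp
  qed
  have "AE \<omega> in S. points num loc \<omega> \<subseteq> W"
    using P1 by eventually_elim simp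
  \<comment> \<open>Labels are grouped by the level of their location. \<open>points\<close> is a
    set, so almost sure injectivity is what identifies the number of labels with the number of
    points.\<close>
  with inj have eq: "AE \<omega> in S. (\<Prod>j<num \<omega>. w (\<kappa> (loc j \<omega>))) = (\<Prod>k\<le>N. w k ^ card (points num loc \<omega> \<inter> B k))"
  proof eventually_elim
    case (elim \<omega>)
    have c: "card {j\<in>{..<num \<omega>}. \<kappa> (loc j \<omega>) = k} = card (points num loc \<omega> \<inter> B k)" for k
    proof -
      have "points num loc \<omega> \<inter> B k = (\<lambda>j. loc j \<omega>) ` {j\<in>{..<num \<omega>}. \<kappa> (loc j \<omega>) = k}"
        using elim(2) by (auto simp: points_def B_def)
      then show ?thesis
        using card_image[OF inj_on_subset[OF elim(1), of "{j\<in>{..<num \<omega>}. \<kappa> (loc j \<omega>) = k}"]]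
        by (metis (no_types, lifting) mem_Collect_eq subsetI)
    qed
    have "(\<Prod>j<num \<omega>. w (\<kappa> (loc j \<omega>))) = (\<Prod>k\<le>N. \<Prod>j\<in>{j\<in>{..<num \<omega>}. \<kappa> (loc j \<omega>) = k}. w (\<kappa> (loc j \<omega>)))"
      by (rule prod.group[symmetric]) (use \<kappa> in auto)
    also have "\<dots> = (\<Prod>k\<le>N. w k ^ card {j\<in>{..<num \<omega>}. \<kappa> (loc j \<omega>) = k})"
      by (intro prod.cong refl) (simp add: prod_constant)
    finally show ?case by (simp only: c)
  qed
  have "indep_vars (\<lambda>_. count_space UNIV) (\<lambda>k \<omega>. card (points num loc \<omega> \<inter> B k)) {..N}"
    by (rule P3) (auto simp: bB disjoint_family_on_def, auto simp: B_def)
  then have ind: "indep_vars (\<lambda>_. borel) (\<lambda>k \<omega>. w k ^ card (points num loc \<omega> \<inter> B k)) {..N}"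
    by (rule indep_vars_compose2[where Y = "\<lambda>k n. w k ^ n"]) simp
  have "(\<integral>\<omega>. (\<Prod>j<num \<omega>. w (\<kappa> (loc j \<omega>))) \<partial>S) = (\<integral>\<omega>. (\<Prod>k\<le>N. w k ^ card (points num loc \<omega> \<inter> B k)) \<partial>S)"
    by (intro integral_cong_AE eq) measurable
  also have "\<dots> = (\<Prod>k\<le>N. \<integral>\<omega>. w k ^ card (points num loc \<omega> \<inter> B k) \<partial>S)"
    using w by (intro indep_vars_lebesgue_integral ind integrable_const_bound[where B = 1])
      (auto simp: power_le_one)
  also have "\<dots> = (\<Prod>k\<le>N. exp (lam * measure lborel (B k) * (w k - 1)))"
    using w by (intro prod.cong refl poisson_pgf cP) auto
  also have "\<dots> = exp (lam * (\<Sum>k\<le>N. measure lborel (B k) * (w k - 1)))"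
    by (simp add: exp_sum sum_distrib_left mult.assoc)
  also have "(\<Sum>k\<le>N. measure lborel (B k) * (w k - 1)) = (\<integral>v. (\<Sum>k\<le>N. indicator (B k) v * (w k - 1)) \<partial>lborel)"
    using W_finite[of "\<kappa> -` {_}"] by (subst Bochner_Integration.integral_sum)
       (auto simp: B_def[symmetric] intro!: integrable_real_indicator integrable_mult_left)
  also have "\<dots> = (\<integral>v. indicator W v * (w (\<kappa> v) - 1) \<partial>lborel)"
  proof (intro Bochner_Integration.integral_cong refl)
    fix v
    have "(\<Sum>k\<le>N. indicator (B k) v * (w k - 1)) = (\<Sum>k\<le>N. if k = \<kappa> v then indicator W v * (w (\<kappa> v) - 1) else 0)"
      by (intro sum.cong) (auto simp: B_def indicator_def)
    then show "(\<Sum>k\<le>N. indicator (B k) v * (w k - 1)) = indicator W v * (w (\<kappa> v) - 1)"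
      using \<kappa>[of v] by simp
  qed
  finally show ?thesis .
qed

text \<open>Round h down to multiples of 1/(n+1), apply the finite-valued case, and pass to the
  limit by dominated convergence on both sides.\<close>

lemma pgf:
  fixes h :: "'a \<Rightarrow> real"
  assumes [measurable]: "h \<in> borel_measurable borel" and h: "\<And>v. 0 \<le> h v" "\<And>v. h v \<le> 1"
  shows "(\<integral>\<omega>. (\<Prod>j<num \<omega>. h (loc j \<omega>)) \<partial>S) = exp (lam * (\<integral>v. indicator W v * (h v - 1) \<partial>lborel))"
proof -
  \<comment> \<open>The grid index is at most \<open>Suc n\<close> because h is at most 1, and the
    rounding error is at most 1/(n+1).\<close>
  define \<kappa> where "\<kappa> n v = nat \<lfloor>real (Suc n) * h v\<rfloor>" for n v
  define w where "w n k = real k / real (Suc n)" for n k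
  have [measurable]: "\<kappa> n \<in> borel \<rightarrow>\<^sub>M count_space UNIV" for n
    unfolding \<kappa>_def by measurable
  have \<kappa>: "\<kappa> n v \<le> Suc n" for n v
  proof -
    have "real (Suc n) * h v \<le> real (Suc n)"
      using h[of v] by (intro mult_left_le) auto
    then show ?thesis unfolding \<kappa>_def by linarith
  qed
  have w: "0 \<le> w n k" "k \<le> Suc n \<Longrightarrow> w n k \<le> 1" for n k
    by (auto simp: w_def field_simps)
  have wk: "\<bar>w n (\<kappa> n v) - h v\<bar> \<le> 1 / real (Suc n)" for n v
  proof -
    have "0 \<le> real (Suc n) * h v" using h by simp
    then have "\<bar>real (\<kappa> n v) - real (Suc n) * h v\<bar> \<le> 1"
      unfolding \<kappa>_def by linarith
    then have "\<bar>real (\<kappa> n v) - real (Suc n) * h v\<bar> / real (Suc n) \<le> 1 / real (Suc n)"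
      by (intro divide_right_mono) auto
    moreover have "w n (\<kappa> n v) - h v = (real (\<kappa> n v) - real (Suc n) * h v) / real (Suc n)"
      unfolding w_def by (simp add: field_simps)
    ultimately show ?thesis
      by (simp add: abs_divide del: of_nat_Suc)
  qed
  have lim: "(\<lambda>n. w n (\<kappa> n v)) \<longlonglongrightarrow> h v" for v
  proof (rule LIM_zero_cancel, rule Lim_null_comparison)
    show "\<forall>\<^sub>F n in sequentially. norm (w n (\<kappa> n v) - h v) \<le> 1 / real (Suc n)"
      using wk by simp
    show "(\<lambda>n. 1 / real (Suc n)) \<longlonglongrightarrow> 0"
      using LIMSEQ_inverse_real_of_nat by (simp add: inverse_eq_divide del: of_nat_Suc)
  qed
  have "(\<lambda>n. \<integral>\<omega>. (\<Prod>j<num \<omega>. w n (\<kappa> n (loc j \<omega>))) \<partial>S) \<longlonglongrightarrow> (\<integral>\<omega>. (\<Prod>j<num \<omega>. h (loc j \<omega>)) \<partial>S)"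
    using w \<kappa> by (intro integral_dominated_convergence[where w = "\<lambda>_. 1"])
      (auto intro!: tendsto_prod lim simp: abs_prod intro!: prod_le_1)
  moreover have "(\<lambda>n. exp (lam * (\<integral>v. indicator W v * (w n (\<kappa> n v) - 1) \<partial>lborel))) \<longlonglongrightarrow>
      exp (lam * (\<integral>v. indicator W v * (h v - 1) \<partial>lborel))"
  proof (intro tendsto_exp tendsto_mult_left integral_dominated_convergence[where w = "indicator W"])
    show "AE v in lborel. (\<lambda>n. indicator W v * (w n (\<kappa> n v) - 1)) \<longlonglongrightarrow> indicator W v * (h v - 1)"
      by (intro AE_I2 tendsto_intros lim)
    show "AE v in lborel. norm (indicator W v * (w n (\<kappa> n v) - 1)) \<le> indicat_real W v" for n
      using w(1)[of n "\<kappa> n _"] w(2)[OF \<kappa>] by (intro AE_I2) (auto simp: indicator_def abs_le_iff)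
    show "integrable lborel (indicat_real W)"
      using W_finite[of UNIV] by (intro integrable_real_indicator) auto
  qed measurable
  moreover have "(\<integral>\<omega>. (\<Prod>j<num \<omega>. w n (\<kappa> n (loc j \<omega>))) \<partial>S) = exp (lam * (\<integral>v. indicator W v * (w n (\<kappa> n v) - 1) \<partial>lborel))" for n
    using w \<kappa> by (intro pgf_step[where N = "Suc n"]) auto
  ultimately show ?thesis
    using LIMSEQ_unique by simp
qed

text \<open>Apply the generating functional to z h. The event of n points contributes z^n times the
  integral in question, while the right side is an exponential series in z; the coefficients must
  agree.\<close>

lemma integral_prod_num_eq:
  fixes h :: "'a \<Rightarrow> real"
  assumes [measurable]: "h \<in> borel_measurable borel" and h: "\<And>v. 0 \<le> h v" "\<And>v. h v \<le> 1" and lam: "0 \<le> lam"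
  shows "(\<integral>\<omega>. (\<Prod>j<n. h (loc j \<omega>)) * indicator {\<omega>\<in>space S. num \<omega> = n} \<omega> \<partial>S) =
    exp (- (lam * measure lborel W)) * (lam * (\<integral>v. indicator W v * h v \<partial>lborel)) ^ n / fact n"
proof -
  define c where "c n = (\<integral>\<omega>. (\<Prod>j<n. h (loc j \<omega>)) * indicator {\<omega>\<in>space S. num \<omega> = n} \<omega> \<partial>S)" for n
  define I where "I = lam * (\<integral>v. indicator W v * h v \<partial>lborel)"
  define e where "e n = exp (- (lam * measure lborel W)) * I ^ n / fact n" for n
  have iW: "integrable lborel (indicat_real W)"
    using W_finite[of UNIV] by (intro integrable_real_indicator) auto
  have iWh: "integrable lborel (\<lambda>v. indicator W v * h v)"
    by (rule Bochner_Integration.integrable_bound[OF iW]) (use h in \<open>auto simp: indicator_def\<close>)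
  have cz: "(\<lambda>n. c n * z ^ n) sums (exp (- (lam * measure lborel W)) * exp (z * I))" if z: "0 \<le> z" "z \<le> 1" for z
  proof -
    have "(\<lambda>n. \<integral>\<omega>. (\<Prod>j<num \<omega>. z * h (loc j \<omega>)) * indicator {\<omega>\<in>space S. num \<omega> = n} \<omega> \<partial>S) sums
        (\<integral>\<omega>. (\<Prod>j<num \<omega>. z * h (loc j \<omega>)) \<partial>S)"
      using z h by (intro sums_integral_nat_partition integrable_const_bound[where B = 1] AE_I2)
        (auto simp: abs_prod abs_mult intro!: prod_le_1 prod_nonneg mult_le_one)
    also have "(\<integral>\<omega>. (\<Prod>j<num \<omega>. z * h (loc j \<omega>)) \<partial>S) = exp (lam * (\<integral>v. indicator W v * (z * h v - 1) \<partial>lborel))"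
      using z h by (intro pgf) (auto intro!: mult_le_one)
    also have "(\<integral>v. indicator W v * (z * h v - 1) \<partial>lborel) = (\<integral>v. z * (indicator W v * h v) - indicator W v \<partial>lborel)"
      by (intro Bochner_Integration.integral_cong) (auto simp: algebra_simps)
    also have "\<dots> = z * (\<integral>v. indicator W v * h v \<partial>lborel) - measure lborel W"
      using iW iWh by simp
    also have "exp (lam * \<dots>) = exp (- (lam * measure lborel W)) * exp (z * I)"
      by (simp add: I_def algebra_simps flip: exp_add)
    also have "(\<lambda>n. \<integral>\<omega>. (\<Prod>j<num \<omega>. z * h (loc j \<omega>)) * indicator {\<omega>\<in>space S. num \<omega> = n} \<omega> \<partial>S) = (\<lambda>n. c n * z ^ n)"
    proof
      fix n
      have "(\<integral>\<omega>. (\<Prod>j<num \<omega>. z * h (loc j \<omega>)) * indicator {\<omega>\<in>space S. num \<omega> = n} \<omega> \<partial>S) =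
          (\<integral>\<omega>. ((\<Prod>j<n. h (loc j \<omega>)) * indicator {\<omega>\<in>space S. num \<omega> = n} \<omega>) * z ^ n \<partial>S)"
        by (intro Bochner_Integration.integral_cong) (auto simp: indicator_def prod.distrib)
      then show "(\<integral>\<omega>. (\<Prod>j<num \<omega>. z * h (loc j \<omega>)) * indicator {\<omega>\<in>space S. num \<omega> = n} \<omega> \<partial>S) = c n * z ^ n"
        by (simp add: c_def)
    qed
    finally show ?thesis .
  qed
  have ez: "(\<lambda>n. e n * z ^ n) sums (exp (- (lam * measure lborel W)) * exp (z * I))" for z
  proof -
    have "(\<lambda>n. exp (- (lam * measure lborel W)) * ((z * I) ^ n /\<^sub>R fact n)) sums (exp (- (lam * measure lborel W)) * exp (z * I))"
      by (intro sums_mult exp_converges)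
    then show ?thesis
      by (simp add: e_def power_mult_distrib divide_inverse mult_ac)
  qed
  \<comment> \<open>Nonnegative coefficients turn convergence at z = 1 into the absolute summability
    needed for comparing coefficients.\<close>
  have "0 \<le> c n" "0 \<le> e n" for n
    using h lam by (auto simp: c_def e_def I_def intro!: integral_nonneg_AE AE_I2 mult_nonneg_nonneg prod_nonneg)
  then have "summable (\<lambda>n. \<bar>c n\<bar>)" "summable (\<lambda>n. \<bar>e n\<bar>)"
    using cz[of 1] ez[of 1] by (auto simp: sums_iff)
  then have "summable (\<lambda>n. \<bar>c n\<bar> + \<bar>e n\<bar>)"
    by (rule summable_add)
  then have "summable (\<lambda>n. \<bar>c n - e n\<bar>)"
    by (rule summable_comparison_test[rotated]) (auto intro: abs_triangle_ineq4)
  moreover have "(\<Sum>n. (c n - e n) * z ^ n) = 0" if "0 \<le> z" "z \<le> 1" for z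
    using sums_diff[OF cz[OF that] ez[of z]] by (simp add: sums_iff left_diff_distrib)
  ultimately have "c n - e n = 0"
    by (rule powser_coeffs_eq_0)
  then show ?thesis
    by (simp add: c_def e_def I_def)
qed

end

section \<open>Conditionally independent marks\<close>

text \<open>\<open>cond_indep_marks\<close> tests the marks against fixed sets only, whereas the
  gain thresholds depend on the conditioning variable. On an event where all the laws equal one
  measure, the joint law of V and the marks is a product measure, and Tonelli's theorem then handles
  sets that vary with V.\<close>

lemma cond_indep_marks_common_law:
  assumes S: "prob_space S" and ci: "cond_indep_marks S N V L I \<kappa> \<xi>"
    and J: "finite J" and E: "E \<in> sets N" "\<And>\<omega>. \<omega> \<in> space S \<Longrightarrow> V \<omega> \<in> E \<Longrightarrow> J \<subseteq> I \<omega>"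
    and \<gamma>: "prob_space \<gamma>" "sets \<gamma> = sets L" "AE \<omega> in S. V \<omega> \<in> E \<longrightarrow> (\<forall>j\<in>J. \<kappa> j \<omega> = \<gamma>)"
    and Q: "\<And>j. j \<in> J \<Longrightarrow> Q j \<in> sets (N \<Otimes>\<^sub>M L)"
  shows "emeasure S {\<omega>\<in>space S. V \<omega> \<in> E \<and> (\<forall>j\<in>J. (V \<omega>, \<xi> j \<omega>) \<in> Q j)} =
    (\<integral>\<^sup>+\<omega>. indicator E (V \<omega>) * (\<Prod>j\<in>J. emeasure \<gamma> (Pair (V \<omega>) -` Q j)) \<partial>S)"
proof -
  interpret prob_space S by fact
  interpret G: prob_space \<gamma> by fact
  interpret GP: product_prob_space "\<lambda>_. \<gamma>" J by unfold_locales
  note V [measurable] = ci[unfolded cond_indep_marks_def, THEN conjunct1]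
  have \<xi> [measurable]: "\<xi> i \<in> S \<rightarrow>\<^sub>M L" for i
    using ci[unfolded cond_indep_marks_def] by blast
  note [measurable] = E(1) Q
  define X where "X \<omega> = (\<lambda>j\<in>J. \<xi> j \<omega>)" for \<omega>
  have setsL: "sets (\<Pi>\<^sub>M j\<in>J. \<gamma>) = sets (\<Pi>\<^sub>M j\<in>J. L)"
    by (intro sets_PiM_cong) (auto simp: \<gamma>)
  have spL: "space \<gamma> = space L"
    using \<gamma>(2) by (rule sets_eq_imp_space_eq)
  have X [measurable]: "X \<in> S \<rightarrow>\<^sub>M (\<Pi>\<^sub>M j\<in>J. L)"
    unfolding X_def by measurable
  \<comment> \<open>The restriction of S to the event that V lies in E, deliberately not normalised,
    so that null events need no separate treatment.\<close>
  define S' where "S' = density S (indicator (V -` E \<inter> space S))"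
  have S' [simp]: "space S' = space S" "sets S' = sets S"
    by (simp_all add: S'_def)
  have mS': "measurable S' = measurable S"
    by (intro ext measurable_cong_sets) simp_all
  define M1 where "M1 = distr S' N V"
  define M2 where "M2 = (\<Pi>\<^sub>M j\<in>J. \<gamma>)"
  define M where "M = distr S' (N \<Otimes>\<^sub>M (\<Pi>\<^sub>M j\<in>J. L)) (\<lambda>\<omega>. (V \<omega>, X \<omega>))"
  have eS': "emeasure S' A = emeasure S {\<omega>\<in>space S. \<omega> \<in> A \<and> V \<omega> \<in> E}" if "A \<in> sets S" for A
    unfolding S'_def using that by (subst emeasure_restricted) (auto intro!: arg_cong2[where f = emeasure])
  have fin: "finite_measure S'"
    by (rule finite_measureI) (simp add: eS')
  have "M1 \<Otimes>\<^sub>M M2 = M"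
  proof (rule pair_measure_eqI)
    show "sigma_finite_measure M1"
      unfolding M1_def by (intro finite_measure.axioms(1) finite_measure.finite_measure_distr[OF fin])
        (simp add: mS')
    show "sigma_finite_measure M2"
      unfolding M2_def by (rule GP.P.sigma_finite_measure_axioms)
    show "sets (M1 \<Otimes>\<^sub>M M2) = sets M"
      unfolding M1_def M2_def M_def sets_distr by (intro sets_pair_measure_cong setsL) simp
    fix A B assume A: "A \<in> sets M1" and B: "B \<in> sets M2"
    then have A' [measurable]: "A \<in> sets N" and B' [measurable]: "B \<in> sets (\<Pi>\<^sub>M j\<in>J. L)"
      by (auto simp: M1_def M2_def setsL)
    define c where "c = emeasure S {\<omega>\<in>space S. V \<omega> \<in> A \<inter> E}"
    define T where "T = density S (indicator (V -` (A \<inter> E) \<inter> space S))"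
    have mT: "measurable T = measurable S"
      by (intro ext measurable_cong_sets) (simp_all add: T_def)
    have eT: "emeasure T C = emeasure S {\<omega>\<in>space S. \<omega> \<in> C \<and> V \<omega> \<in> A \<inter> E}" if "C \<in> sets S" for C
      unfolding T_def using that by (subst emeasure_restricted) (auto intro!: arg_cong2[where f = emeasure])
    have sT: "space T = space S"
      by (simp add: T_def)
    \<comment> \<open>For fixed A this is an equality of finite measures on a finite product, which
      boxes determine; on boxes it is exactly the defining property of the marks.\<close>
    have "distr T (\<Pi>\<^sub>M j\<in>J. L) X = scale_measure c M2"
    proof (rule measure_eqI_PiM_finite[OF J])
      show "sets (distr T (Pi\<^sub>M J (\<lambda>_. L)) X) = sets (Pi\<^sub>M J (\<lambda>_. L))"
        "sets (scale_measure c M2) = sets (Pi\<^sub>M J (\<lambda>_. L))"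
        by (simp_all add: M2_def setsL)
      show "range (\<lambda>_::nat. space (Pi\<^sub>M J (\<lambda>_. L))) \<subseteq> prod_algebra J (\<lambda>_. L)"
        using space_in_prod_algebra[of J "\<lambda>_. L"] by (auto simp: space_PiM)
      show "(\<Union>i::nat. space (Pi\<^sub>M J (\<lambda>_. L))) = space (Pi\<^sub>M J (\<lambda>_. L))"
        by simp
      have "emeasure (distr T (Pi\<^sub>M J (\<lambda>_. L)) X) (space (Pi\<^sub>M J (\<lambda>_. L))) \<le> 1"
        by (subst emeasure_distr) (auto simp: mT sT eT emeasure_le_1)
      then show "emeasure (distr T (Pi\<^sub>M J (\<lambda>_. L)) X) (space (Pi\<^sub>M J (\<lambda>_. L))) \<noteq> \<infinity>"
        by (auto simp: top_unique)
      fix B assume B: "\<And>j. j \<in> J \<Longrightarrow> B j \<in> sets L"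
      then have [measurable]: "Pi\<^sub>E J B \<in> sets (Pi\<^sub>M J (\<lambda>_. L))"
        using J by (intro sets_PiM_I_finite) auto
      have "emeasure (distr T (Pi\<^sub>M J (\<lambda>_. L)) X) (Pi\<^sub>E J B) =
          emeasure S {\<omega>\<in>space S. V \<omega> \<in> A \<inter> E \<and> (\<forall>j\<in>J. \<xi> j \<omega> \<in> B j)}"
        by (subst emeasure_distr) (auto simp: mT eT sT
             X_def PiE_iff intro!: arg_cong2[where f = emeasure])
      also have "\<dots> = (\<integral>\<^sup>+\<omega>. indicator {\<omega>\<in>space S. V \<omega> \<in> A \<inter> E} \<omega> * (\<Prod>j\<in>J. emeasure (\<kappa> j \<omega>) (B j)) \<partial>S)"
        using ci[unfolded cond_indep_marks_def, THEN conjunct2, THEN conjunct2, rule_format, of "A \<inter> E" J B]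
          J B E(2) by auto
      also have "\<dots> = (\<integral>\<^sup>+\<omega>. (\<Prod>j\<in>J. emeasure \<gamma> (B j)) * indicator {\<omega>\<in>space S. V \<omega> \<in> A \<inter> E} \<omega> \<partial>S)"
        using \<gamma>(3) by (intro nn_integral_cong_AE) (auto elim!: eventually_mono simp: indicator_def intro!: prod.cong)
      also have "\<dots> = (\<Prod>j\<in>J. emeasure \<gamma> (B j)) * c"
        unfolding c_def by (intro nn_integral_cmult_indicator) measurable
      also have "\<dots> = emeasure (scale_measure c M2) (Pi\<^sub>E J B)"
        using J B \<gamma> by (simp add: M2_def GP.emeasure_PiM mult.commute)
      finally show "emeasure (distr T (Pi\<^sub>M J (\<lambda>_. L)) X) (Pi\<^sub>E J B) = emeasure (scale_measure c M2) (Pi\<^sub>E J B)" .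
    qed
    moreover have "emeasure (distr T (\<Pi>\<^sub>M j\<in>J. L) X) B = emeasure S {\<omega>\<in>space S. X \<omega> \<in> B \<and> V \<omega> \<in> A \<inter> E}"
      by (subst emeasure_distr) (auto simp: mT eT sT intro!: arg_cong2[where f = emeasure])
    ultimately have "c * emeasure M2 B = emeasure S {\<omega>\<in>space S. X \<omega> \<in> B \<and> V \<omega> \<in> A \<inter> E}"
      by simp
    moreover have "emeasure M1 A = c"
      unfolding M1_def c_def
      by (subst emeasure_distr) (auto simp: mS' eS' intro!: arg_cong2[where f = emeasure])
    moreover have "emeasure M (A \<times> B) = emeasure S {\<omega>\<in>space S. X \<omega> \<in> B \<and> V \<omega> \<in> A \<inter> E}"
      unfolding M_def
      by (subst emeasure_distr) (auto simp: mS' eS' intro!: arg_cong2[where f = emeasure])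
    ultimately show "emeasure M1 A * emeasure M2 B = emeasure M (A \<times> B)"
      by simp
  qed
  \<comment> \<open>The requirement on all marks as one set of the product space; its section at v
    is a box, so its measure is a product.\<close>
  define Z where "Z = {z \<in> space (N \<Otimes>\<^sub>M (\<Pi>\<^sub>M j\<in>J. L)). \<forall>j\<in>J. (fst z, snd z j) \<in> Q j}"
  have Z [measurable]: "Z \<in> sets (N \<Otimes>\<^sub>M (\<Pi>\<^sub>M j\<in>J. L))"
    unfolding Z_def using J by measurable
  have "emeasure S {\<omega>\<in>space S. V \<omega> \<in> E \<and> (\<forall>j\<in>J. (V \<omega>, \<xi> j \<omega>) \<in> Q j)} = emeasure M Z"
  proof -
    have "(\<lambda>\<omega>. (V \<omega>, X \<omega>)) -` Z \<inter> space S' = {\<omega>\<in>space S. \<forall>j\<in>J. (V \<omega>, \<xi> j \<omega>) \<in> Q j}"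
      using measurable_space[OF X] measurable_space[OF V] by (auto simp: Z_def space_pair_measure X_def)
    moreover have "{\<omega>\<in>space S. \<forall>j\<in>J. (V \<omega>, \<xi> j \<omega>) \<in> Q j} \<in> sets S"
      using J by measurable
    ultimately show ?thesis
      unfolding M_def by (subst emeasure_distr) (auto simp: mS' eS' intro!: arg_cong2[where f = emeasure])
  qed
  also have "\<dots> = (\<integral>\<^sup>+v. emeasure M2 (Pair v -` Z) \<partial>M1)"
    unfolding \<open>M1 \<Otimes>\<^sub>M M2 = M\<close>[symmetric]
    by (rule GP.P.emeasure_pair_measure_alt[folded M2_def])
       (use Z in \<open>simp only: \<open>M1 \<Otimes>\<^sub>M M2 = M\<close> M_def sets_distr\<close>)
  also have "\<dots> = (\<integral>\<^sup>+v. (\<Prod>j\<in>J. emeasure \<gamma> (Pair v -` Q j)) \<partial>M1)"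
  proof (intro nn_integral_cong)
    fix v assume v: "v \<in> space M1"
    have "Pair v -` Q j \<in> sets L" if "j \<in> J" for j
      using Q[OF that] by (rule sets_Pair1)
    moreover from this have "y \<in> space L" if "j \<in> J" "(v, y) \<in> Q j" for j y
      using sets.sets_into_space that by blast
    then have "Pair v -` Z = (\<Pi>\<^sub>E j\<in>J. Pair v -` Q j)"
      using v by (intro set_eqI) (auto simp: Z_def M1_def space_pair_measure space_PiM PiE_iff)
    ultimately show "emeasure M2 (Pair v -` Z) = (\<Prod>j\<in>J. emeasure \<gamma> (Pair v -` Q j))"
      using J \<gamma>(2) by (simp add: M2_def GP.emeasure_PiM)
  qed
  also have "\<dots> = (\<integral>\<^sup>+\<omega>. indicator E (V \<omega>) * (\<Prod>j\<in>J. emeasure \<gamma> (Pair (V \<omega>) -` Q j)) \<partial>S)"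
  proof -
    have [measurable]: "(\<lambda>v. emeasure \<gamma> (Pair v -` Q j)) \<in> borel_measurable N" if "j \<in> J" for j
      by (rule G.measurable_emeasure_Pair) (simp add: Q that sets_pair_measure_cong[OF refl \<gamma>(2)])
    then have [measurable]: "(\<lambda>v. \<Prod>j\<in>J. emeasure \<gamma> (Pair v -` Q j)) \<in> borel_measurable N"
      by measurable
    show ?thesis
      unfolding M1_def S'_def
      by (subst nn_integral_distr, simp add: mS'[unfolded S'_def], simp, subst nn_integral_density)
        (auto intro!: nn_integral_cong simp: indicator_def)
  qed
  finally show ?thesis .
qed

text \<open>Independence makes the joint law a product. The second variable is integrated outermost,
  so that the interference is a fixed parameter of the inner integral.\<close>

lemma nn_integral_indep_rvs:
  assumes S: "prob_space S" and ind: "indep_rvs S N V L W"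
    and [measurable]: "f \<in> borel_measurable (N \<Otimes>\<^sub>M L)"
  shows "(\<integral>\<^sup>+\<omega>. f (V \<omega>, W \<omega>) \<partial>S) = (\<integral>\<^sup>+\<omega>'. \<integral>\<^sup>+\<omega>. f (V \<omega>, W \<omega>') \<partial>S \<partial>S)"
proof -
  interpret prob_space S by fact
  have [measurable]: "V \<in> S \<rightarrow>\<^sub>M N" "W \<in> S \<rightarrow>\<^sub>M L"
    and ind': "indep_set {V -` A \<inter> space S |A. A \<in> sets N} {W -` A \<inter> space S |A. A \<in> sets L}"
    using ind by (auto simp: indep_rvs_def)
  interpret DV: prob_space "distr S N V" by (rule prob_space_distr) simp
  interpret DW: prob_space "distr S L W" by (rule prob_space_distr) simp
  interpret P: pair_sigma_finite "distr S N V" "distr S L W" ..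
  have "distr S N V \<Otimes>\<^sub>M distr S L W = distr S (N \<Otimes>\<^sub>M L) (\<lambda>\<omega>. (V \<omega>, W \<omega>))"
  proof (rule pair_measure_eqI)
    fix A B assume "A \<in> sets (distr S N V)" "B \<in> sets (distr S L W)"
    then have [measurable]: "A \<in> sets N" "B \<in> sets L" by auto
    have "emeasure S ((V -` A \<inter> space S) \<inter> (W -` B \<inter> space S)) =
        emeasure S (V -` A \<inter> space S) * emeasure S (W -` B \<inter> space S)"
    proof -
      have "prob ((V -` A \<inter> space S) \<inter> (W -` B \<inter> space S)) = prob (V -` A \<inter> space S) * prob (W -` B \<inter> space S)"
        by (rule indep_setD[OF ind']) (use \<open>A \<in> sets N\<close> \<open>B \<in> sets L\<close> in blast)+
      then show ?thesis
        by (simp add: emeasure_eq_measure ennreal_mult)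
    qed
    moreover have "(\<lambda>\<omega>. (V \<omega>, W \<omega>)) -` (A \<times> B) \<inter> space S = (V -` A \<inter> space S) \<inter> (W -` B \<inter> space S)"
      by auto
    ultimately show "emeasure (distr S N V) A * emeasure (distr S L W) B =
        emeasure (distr S (N \<Otimes>\<^sub>M L) (\<lambda>\<omega>. (V \<omega>, W \<omega>))) (A \<times> B)"
      by (simp add: emeasure_distr)
  qed (simp_all add: DV.sigma_finite_measure_axioms DW.sigma_finite_measure_axioms cong: sets_pair_measure_cong)
  then have "(\<integral>\<^sup>+\<omega>. f (V \<omega>, W \<omega>) \<partial>S) = (\<integral>\<^sup>+z. f z \<partial>(distr S N V \<Otimes>\<^sub>M distr S L W))"
    by (simp add: nn_integral_distr)
  also have "\<dots> = (\<integral>\<^sup>+w. \<integral>\<^sup>+v. f (v, w) \<partial>distr S N V \<partial>distr S L W)"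
    by (subst P.nn_integral_snd[symmetric]) (simp_all cong: measurable_cong_sets sets_pair_measure_cong)
  also have "\<dots> = (\<integral>\<^sup>+\<omega>'. \<integral>\<^sup>+\<omega>. f (V \<omega>, W \<omega>') \<partial>S \<partial>S)"
  proof -
    have "(\<integral>\<^sup>+v. f (v, w) \<partial>distr S N V) = (\<integral>\<^sup>+\<omega>. f (V \<omega>, w) \<partial>S)" if "w \<in> space L" for w
      using that by (intro nn_integral_distr) auto
    moreover have "(\<lambda>w. \<integral>\<^sup>+v. f (v, w) \<partial>distr S N V) \<in> borel_measurable L"
      by (rule DV.borel_measurable_nn_integral) (simp cong: measurable_cong_sets sets_pair_measure_cong add: split_beta')
    ultimately show ?thesis
      by (subst nn_integral_distr) (auto intro!: nn_integral_cong dest: measurable_space[OF \<open>W \<in> S \<rightarrow>\<^sub>M L\<close>])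
  qed
  finally show ?thesis .
qed

text \<open>Proportionality on events extends to integrals because the two restricted image measures
  are proportional. Here C will be a caching pattern, D the event of n RUs, and r the probability of
  the pattern.\<close>

lemma nn_integral_proportional_on:
  assumes V [measurable]: "V \<in> S \<rightarrow>\<^sub>M N" and [measurable]: "C \<in> sets S" "D \<in> sets S" "f \<in> borel_measurable N"
    and eq: "\<And>E. E \<in> sets N \<Longrightarrow>
      emeasure S {\<omega>\<in>space S. V \<omega> \<in> E \<and> \<omega> \<in> C} = r * emeasure S {\<omega>\<in>space S. V \<omega> \<in> E \<and> \<omega> \<in> D}"
  shows "(\<integral>\<^sup>+\<omega>. f (V \<omega>) * indicator C \<omega> \<partial>S) = r * (\<integral>\<^sup>+\<omega>. f (V \<omega>) * indicator D \<omega> \<partial>S)"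
proof -
  have e: "emeasure (distr (density S (indicator C)) N V) E = emeasure S {\<omega>\<in>space S. V \<omega> \<in> E \<and> \<omega> \<in> C}"
    if [measurable]: "E \<in> sets N" "C \<in> sets S" for E C
    using that by (subst emeasure_distr, simp, simp, subst emeasure_restricted)
      (auto intro!: arg_cong2[where f = emeasure])
  have "distr (density S (indicator C)) N V = scale_measure r (distr (density S (indicator D)) N V)"
    by (rule measure_eqI) (simp_all add: e eq)
  then have "(\<integral>\<^sup>+v. f v \<partial>distr (density S (indicator C)) N V) = r * (\<integral>\<^sup>+v. f v \<partial>distr (density S (indicator D)) N V)"
    by (simp add: nn_integral_scale_measure)
  then show ?thesis
    by (simp add: nn_integral_distr nn_integral_density mult.commute)
qed

section \<open>The probability of missing a single RU\<close>

text \<open>The gains at location y that do not exceed the threshold under interference s, written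
  with the same \<open>ennreal\<close> division as \<open>sinr_best\<close> so that zero and
  infinite denominators are treated alike.\<close>

definition miss_set :: "real \<Rightarrow> real \<Rightarrow> real \<Rightarrow> real \<Rightarrow> 'a::real_normed_vector \<Rightarrow> ennreal \<Rightarrow> real set" where
  "miss_set P \<alpha> \<beta> \<sigma>2 y s = {x. ennreal (P * x * norm y powr - \<alpha>) / (ennreal \<sigma>2 + s) \<le> ennreal \<beta>}"

lemma miss_set_top: "miss_set P \<alpha> \<beta> \<sigma>2 y \<top> = UNIV"
  by (simp add: miss_set_def)

text \<open>If \<open>s + \<sigma>2 = 0\<close>, then the ratio is \<open>0 / 0 = 0\<close> for \<open>x \<le> 0\<close> and \<open>\<infinity>\<close> for \<open>x > 0\<close>, in accordance with
  the threshold \<open>0\<close>.\<close>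

lemma miss_set_finite:
  assumes P: "0 < P" "0 < \<beta>" "0 \<le> \<sigma>2" and y: "y \<noteq> 0" and s: "s \<noteq> \<infinity>"
  shows "miss_set P \<alpha> \<beta> \<sigma>2 y s = {..\<beta> * (enn2real s + \<sigma>2) * norm y powr \<alpha> / P}"
proof -
  define a where "a = P * norm y powr - \<alpha>"
  define t where "t = enn2real s + \<sigma>2"
  have a: "0 < a" "norm y powr \<alpha> / P = 1 / a"
    using P y by (auto simp: a_def powr_minus field_simps)
  have t: "0 \<le> t" "ennreal \<sigma>2 + s = ennreal t"
    using P s by (auto simp: t_def add.commute ennreal_plus less_top)
  have "ennreal (P * x * norm y powr - \<alpha>) / (ennreal \<sigma>2 + s) \<le> ennreal \<beta> \<longleftrightarrow> x * a \<le> \<beta> * t" for x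
  proof -
    have "P * x * norm y powr - \<alpha> = x * a" by (simp add: a_def)
    moreover have "ennreal (x * a) / ennreal t \<le> ennreal \<beta> \<longleftrightarrow> x * a \<le> \<beta> * t"
    proof (cases "x * a \<le> 0")
      case True
      then have "ennreal (x * a) = 0" by (simp add: ennreal_neg)
      moreover have "x * a \<le> \<beta> * t" using True P t mult_nonneg_nonneg[of \<beta> t] by linarith
      ultimately show ?thesis by (simp add: zero_le)
    next
      case pos: False
      show ?thesis
      proof (cases "t = 0")
        case True
        with pos show ?thesis by (auto simp: ennreal_divide_zero top_unique)
      next
        case False
        with pos t P show ?thesis by (simp add: divide_ennreal pos_divide_le_eq)
      qed
    qed
    ultimately show ?thesis by (simp only: t)
  qed
  also have "x * a \<le> \<beta> * t \<longleftrightarrow> x \<le> \<beta> * t * norm y powr \<alpha> / P" for x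
  proof -
    have "\<beta> * t * norm y powr \<alpha> / P = \<beta> * t / a"
      using a(2) by (metis mult.right_neutral times_divide_eq_right)
    then show ?thesis
      using a(1) by (simp add: pos_le_divide_eq)
  qed
  finally show ?thesis
    by (auto simp: miss_set_def t_def)
qed

lemma measure_gain_law_atMost:
  assumes "0 \<le> t"
  shows "measure (gain_law M l) {..t} = 1 - (\<Sum>m\<le>M - l. t ^ m / fact m * exp (- t))"
proof -
  interpret prob_space "gain_law M l" by (rule prob_space_gain_law)
  have "{..t} = space (gain_law M l) - {t<..}" by (auto simp: gain_law_def)
  moreover have "{t<..} \<in> events" by (simp add: gain_law_def)
  ultimately show ?thesis
    using gain_law_tail[OF assms, of M l] by (simp add: prob_compl)
qed

definition miss_prob :: "nat \<Rightarrow> real \<Rightarrow> real \<Rightarrow> real \<Rightarrow> real \<Rightarrow> nat \<Rightarrow> ennreal \<Rightarrow> 'a::real_normed_vector \<Rightarrow> real" where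
  "miss_prob M P \<alpha> \<beta> \<sigma>2 l s y = measure (gain_law M l) (miss_set P \<alpha> \<beta> \<sigma>2 y s)"

lemma sets_gain_law [simp, measurable_cong]: "sets (gain_law M l) = sets borel"
  by (simp add: gain_law_def)

lemma miss_prob_bounds: "0 \<le> miss_prob M P \<alpha> \<beta> \<sigma>2 l s y" "miss_prob M P \<alpha> \<beta> \<sigma>2 l s y \<le> 1"
  by (simp_all add: miss_prob_def prob_space.prob_le_1[OF prob_space_gain_law])

lemma emeasure_miss_set: "emeasure (gain_law M l) (miss_set P \<alpha> \<beta> \<sigma>2 y s) = ennreal (miss_prob M P \<alpha> \<beta> \<sigma>2 l s y)"
  by (simp add: miss_prob_def finite_measure.emeasure_eq_measure prob_space.finite_measure prob_space_gain_law)

lemma miss_set_measurable: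
  "{z \<in> space ((borel \<Otimes>\<^sub>M borel) \<Otimes>\<^sub>M borel). snd z \<in> miss_set P \<alpha> \<beta> \<sigma>2 (snd (fst z) :: 'a::euclidean_space) (fst (fst z))}
     \<in> sets ((borel \<Otimes>\<^sub>M borel) \<Otimes>\<^sub>M borel)"
  unfolding miss_set_def mem_Collect_eq by measurable

lemma miss_prob_measurable [measurable]:
  assumes [measurable]: "f \<in> borel_measurable N" "h \<in> borel_measurable N"
  shows "(\<lambda>x. miss_prob M P \<alpha> \<beta> \<sigma>2 l (f x) (h x :: 'a::euclidean_space)) \<in> borel_measurable N"
proof -
  interpret prob_space "gain_law M l" by (rule prob_space_gain_law)
  have "(\<lambda>z. emeasure (gain_law M l) (Pair z -` {z \<in> space ((borel \<Otimes>\<^sub>M borel) \<Otimes>\<^sub>M borel).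
      snd z \<in> miss_set P \<alpha> \<beta> \<sigma>2 (snd (fst z) :: 'a) (fst (fst z))})) \<in> borel_measurable (borel \<Otimes>\<^sub>M borel)"
    by (rule measurable_emeasure_Pair) (simp add: miss_set_measurable cong: sets_pair_measure_cong)
  then have "(\<lambda>z. miss_prob M P \<alpha> \<beta> \<sigma>2 l (fst z) (snd z :: 'a)) \<in> borel_measurable (borel \<Otimes>\<^sub>M borel)"
    by (simp add: miss_prob_def[abs_def] measure_def space_pair_measure vimage_def)
  from measurable_compose[OF _ this, of "\<lambda>x. (f x, h x)" N] show ?thesis
    by simp
qed

text \<open>One term of a nonnegative exponential series is at most its sum. This dominates the
  integrands below by the radial density.\<close>

lemma power_div_fact_exp_le: "0 \<le> (t::real) \<Longrightarrow> t ^ m / fact m * exp (- t) \<le> 1"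
proof -
  assume t: "0 \<le> t"
  have "t ^ m /\<^sub>R fact m \<le> (\<Sum>n. t ^ n /\<^sub>R fact n)"
    using t sum_le_suminf[OF summable_exp_generic[of t], of "{m}"] by simp
  then have "t ^ m / fact m \<le> exp t"
    by (simp add: exp_def divide_inverse mult.commute)
  then show ?thesis
    by (simp add: exp_minus field_simps)
qed

lemma integral_norm_uniform_disk:
  fixes xo :: "real ^ 2" and G :: "real \<Rightarrow> real"
  assumes D: "0 < D" "norm xo \<le> D" and [measurable]: "G \<in> borel_measurable borel"
  shows "(\<integral>v. indicator (cball xo D) v * G (norm v) \<partial>lborel) =
    pi * D\<^sup>2 * (\<integral>r. radial_density D (norm xo) r * G r \<partial>lborel)"
proof -
  note [measurable] = radial_density_measurable[OF D]
  have [measurable]: "cball xo D \<in> sets borel" by (intro borel_closed closed_cball)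
  have A: "emeasure lborel (cball xo D) = ennreal (pi * D\<^sup>2)"
    using D by (simp add: emeasure_cball unit_ball_vol_2)
  have "uniform_measure lborel (cball xo D) = density lborel (\<lambda>v. ennreal (indicator (cball xo D) v / (pi * D\<^sup>2)))"
    unfolding uniform_measure_def A using D
    by (intro density_cong) (auto simp: divide_ennreal[symmetric] ennreal_indicator)
  then have "(\<integral>r. G r \<partial>distr (uniform_measure lborel (cball xo D)) borel norm) =
      (\<integral>v. indicator (cball xo D) v / (pi * D\<^sup>2) * G (norm v) \<partial>lborel)"
    using D by (simp add: integral_distr integral_density)
  also have "\<dots> = (\<integral>v. indicator (cball xo D) v * G (norm v) \<partial>lborel) / (pi * D\<^sup>2)"
    by (simp flip: integral_divide_zero)
  finally have "(\<integral>v. indicator (cball xo D) v * G (norm v) \<partial>lborel) =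
      pi * D\<^sup>2 * (\<integral>r. G r \<partial>distr (uniform_measure lborel (cball xo D)) borel norm)"
    using D by (simp add: field_simps)
  also have "\<dots> = pi * D\<^sup>2 * (\<integral>r. radial_density D (norm xo) r * G r \<partial>lborel)"
    unfolding distr_norm_uniform_disk[OF D]
    by (subst integral_density) (auto simp: radial_density_nonneg[OF D])
  finally show ?thesis .
qed

lemma integrable_radial_density:
  fixes xo :: "real ^ 2"
  assumes D: "0 < D" "norm xo \<le> D"
  shows "integrable lborel (radial_density D (norm xo))" "(\<integral>r. radial_density D (norm xo) r \<partial>lborel) = 1"
proof -
  note [measurable] = radial_density_measurable[OF D]
  have [measurable]: "cball xo D \<in> sets borel" by (intro borel_closed closed_cball)
  have A: "measure lborel (cball xo D) = pi * D\<^sup>2"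
    using D by (simp add: content_cball_2)
  show one: "(\<integral>r. radial_density D (norm xo) r \<partial>lborel) = 1"
    using integral_norm_uniform_disk[OF D, of "\<lambda>_. 1"] D by (simp add: A)
  \<comment> \<open>A non-integrable function would have Bochner integral 0, not 1.\<close>
  show "integrable lborel (radial_density D (norm xo))"
    using one not_integrable_integral_eq by fastforce
qed

text \<open>At distance r the gain must stay below the threshold \<open>\<tau> r\<close>, so the
  Erlang tail gives the miss probability; averaging over the disk depends on the location only
  through its norm and becomes an integral against the radial density.\<close>

lemma integral_miss_prob:
  fixes xo :: "real ^ 2"
  assumes D: "0 < D" "norm xo \<le> D" and P: "0 < P" "0 < \<beta>" "0 \<le> \<sigma>2" and s: "s \<noteq> \<infinity>"
  shows "(\<integral>v. indicator (cball xo D) v * miss_prob M P \<alpha> \<beta> \<sigma>2 l s v \<partial>lborel) =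
    pi * D\<^sup>2 * miss_factor M P \<beta> \<alpha> D (norm xo) l (enn2real s + \<sigma>2)"
proof -
  note [measurable] = radial_density_measurable[OF D]
  have [measurable]: "cball xo D \<in> sets borel" by (intro borel_closed closed_cball)
  define t where "t = enn2real s + \<sigma>2"
  have t: "0 \<le> t" using P by (simp add: t_def)
  define \<tau> where "\<tau> r = \<beta> * t * r powr \<alpha> / P" for r
  have \<tau>: "0 \<le> \<tau> r" for r using P t by (simp add: \<tau>_def)
  have [measurable]: "\<tau> \<in> borel_measurable borel" unfolding \<tau>_def by measurable
  let ?f = "radial_density D (norm xo)"
  let ?h = "\<lambda>m r. \<tau> r ^ m / fact m * exp (- \<tau> r)"
  have int: "integrable lborel (\<lambda>r. ?f r * ?h m r)" for m
  proof (rule Bochner_Integration.integrable_bound[OF integrable_radial_density(1)[OF D]])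
    show "AE r in lborel. norm (?f r * ?h m r) \<le> norm (?f r)"
    proof (rule AE_I2)
      fix r
      have "\<bar>?h m r\<bar> \<le> 1" using power_div_fact_exp_le[OF \<tau>[of r], of m] \<tau>[of r] by simp
      then show "norm (?f r * ?h m r) \<le> norm (?f r)"
        unfolding real_norm_def abs_mult[of "?f r"] by (rule mult_left_le) simp
    qed
  qed measurable
  have moment: "(\<integral>r. ?f r * ?h m r \<partial>lborel) = \<beta> ^ m * t ^ m / (P ^ m * fact m) *
      (LBINT y:{0..D + norm xo}. y powr (\<alpha> * real m) * exp (- (\<beta> * t * y powr \<alpha> / P)) * dist_density D (norm xo) y)" for m
  proof -
    have [measurable]: "dist_density D (norm xo) \<in> borel_measurable borel"
    proof -
      have "dist_density D (norm xo) = (\<lambda>y. if y = D - norm xo then dist_density D (norm xo) (D - norm xo) else ?f y)"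
        by (auto simp: radial_density_def)
      moreover have "(\<lambda>y. if y = D - norm xo then dist_density D (norm xo) (D - norm xo) else ?f y) \<in> borel_measurable borel"
        by measurable
      ultimately show ?thesis by simp
    qed
    have "(\<integral>r. ?f r * ?h m r \<partial>lborel) = (\<integral>y. \<beta> ^ m * t ^ m / (P ^ m * fact m) * (indicator {0..D + norm xo} y *
       (y powr (\<alpha> * real m) * exp (- (\<beta> * t * y powr \<alpha> / P)) * dist_density D (norm xo) y)) \<partial>lborel)"
    proof (rule integral_cong_AE)
      \<comment> \<open>The point 0 is excluded because \<open>0 powr 0 = 0\<close>, whereas the
        zeroth power of \<open>\<tau> 0\<close> is 1. At the junk point of
        \<open>dist_density\<close> the two densities may differ as well.\<close>
      show "AE y in lborel. ?f y * ?h m y = \<beta> ^ m * t ^ m / (P ^ m * fact m) * (indicator {0..D + norm xo} y *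
       (y powr (\<alpha> * real m) * exp (- (\<beta> * t * y powr \<alpha> / P)) * dist_density D (norm xo) y))"
        using AE_lborel_singleton[of 0] AE_dist_density[of D "norm xo"]
      proof eventually_elim
        case (elim y)
        show ?case
        proof (cases "0 < y \<and> y < D + norm xo")
          case True
          then have "y powr (\<alpha> * real m) = (y powr \<alpha>) ^ m"
            by (simp add: powr_powr[symmetric] powr_realpow)
          with True elim show ?thesis
            by (simp add: \<tau>_def power_mult_distrib power_divide)
        next
          case False
          then have "?f y = 0"
            using elim D by (intro radial_density_eq_0) auto
          with elim show ?thesis by simp
        qed
      qed
    qed measurable
    also have "\<dots> = \<beta> ^ m * t ^ m / (P ^ m * fact m) *
      (LBINT y:{0..D + norm xo}. y powr (\<alpha> * real m) * exp (- (\<beta> * t * y powr \<alpha> / P)) * dist_density D (norm xo) y)"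
      by (subst integral_mult_right_zero) (simp add: set_lebesgue_integral_def)
    finally show ?thesis .
  qed
  have "(\<integral>v. indicator (cball xo D) v * miss_prob M P \<alpha> \<beta> \<sigma>2 l s v \<partial>lborel) =
      (\<integral>v. indicator (cball xo D) v * (1 - (\<Sum>m\<le>M - l. ?h m (norm v))) \<partial>lborel)"
  proof (rule integral_cong_AE)
    \<comment> \<open>At the origin \<open>0 powr - \<alpha> = 0\<close> makes every gain a miss, in
      conflict with the threshold formula; that location is a null set.\<close>
    show "AE v in lborel. indicator (cball xo D) v * miss_prob M P \<alpha> \<beta> \<sigma>2 l s v =
        indicator (cball xo D) v * (1 - (\<Sum>m\<le>M - l. ?h m (norm v)))"
      using AE_lborel_singleton[of 0]
    proof eventually_elim
      case (elim v)
      then show ?case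
        using miss_set_finite[OF P elim s, of \<alpha>] measure_gain_law_atMost[OF \<tau>[of "norm v"], of M l]
        by (simp add: miss_prob_def \<tau>_def t_def)
    qed
  qed measurable
  also have "\<dots> = pi * D\<^sup>2 * (\<integral>r. ?f r * (1 - (\<Sum>m\<le>M - l. ?h m r)) \<partial>lborel)"
    by (rule integral_norm_uniform_disk[OF D]) measurable
  also have "(\<integral>r. ?f r * (1 - (\<Sum>m\<le>M - l. ?h m r)) \<partial>lborel) = (\<integral>r. ?f r - (\<Sum>m\<le>M - l. ?f r * ?h m r) \<partial>lborel)"
    by (simp add: right_diff_distrib sum_distrib_left)
  also have "\<dots> = 1 - (\<Sum>m\<le>M - l. \<integral>r. ?f r * ?h m r \<partial>lborel)"
    using int integrable_radial_density[OF D] by (simp add: Bochner_Integration.integral_sum)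
  finally show ?thesis
    by (simp only: moment miss_factor_def t_def)
qed

text \<open>The miss probability of one uniformly placed RU at interference s. As an average of
  probabilities it visibly lies in [0, 1] and is measurable in s, which the explicit
  \<open>miss_factor\<close> does not show.\<close>

definition mean_miss :: "nat \<Rightarrow> real \<Rightarrow> real \<Rightarrow> real \<Rightarrow> real \<Rightarrow> real \<Rightarrow> real ^ 2 \<Rightarrow> nat \<Rightarrow> ennreal \<Rightarrow> real" where
  "mean_miss M P \<alpha> \<beta> \<sigma>2 D xo l s =
     (\<integral>v. indicator (cball xo D) v * miss_prob M P \<alpha> \<beta> \<sigma>2 l s v \<partial>lborel) / (pi * D\<^sup>2)"

text \<open>Infinite interference makes the ratio 0 and hence every gain a miss; this is the source
  of the value 1 that \<open>R_coeff\<close> takes there.\<close>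

lemma mean_miss_eq:
  assumes D: "0 < D" "norm xo \<le> D" and P: "0 < P" "0 < \<beta>" "0 \<le> \<sigma>2"
  shows "mean_miss M P \<alpha> \<beta> \<sigma>2 D xo l s =
    (if s = \<infinity> then 1 else miss_factor M P \<beta> \<alpha> D (norm xo) l (enn2real s + \<sigma>2))"
proof (cases "s = \<infinity>")
  case True
  have "miss_prob M P \<alpha> \<beta> \<sigma>2 l s v = 1" for v :: "real ^ 2"
    using prob_space.prob_space[OF prob_space_gain_law, of M l]
    by (simp add: True miss_prob_def miss_set_top gain_law_def)
  then show ?thesis
    using D True by (simp add: mean_miss_def content_cball_2)
next
  case False
  then show ?thesis
    using D by (simp add: mean_miss_def integral_miss_prob[OF D P])
qed

lemma mean_miss_measurable [measurable]: "mean_miss M P \<alpha> \<beta> \<sigma>2 D xo l \<in> borel_measurable borel"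
proof -
  have [measurable]: "cball xo D \<in> sets borel" by (intro borel_closed closed_cball)
  show ?thesis
    unfolding mean_miss_def[abs_def]
    by (intro borel_measurable_divide lborel.borel_measurable_lebesgue_integral) measurable
qed

lemma integrable_disk_miss_prob:
  "integrable lborel (\<lambda>v :: real ^ 2. indicator (cball xo D) v * miss_prob M P \<alpha> \<beta> \<sigma>2 l s v)"
proof -
  have [measurable]: "cball xo D \<in> sets borel" by (intro borel_closed closed_cball)
  have "integrable lborel (indicat_real (cball xo D))"
    using emeasure_lborel_cball_finite[of xo D] by (intro integrable_real_indicator) auto
  then show ?thesis
    by (rule Bochner_Integration.integrable_bound) (auto simp: indicator_def miss_prob_bounds)
qed

lemma mean_miss_bounds:
  assumes "0 < D"
  shows "0 \<le> mean_miss M P \<alpha> \<beta> \<sigma>2 D xo l s" "mean_miss M P \<alpha> \<beta> \<sigma>2 D xo l s \<le> 1"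
proof -
  have [measurable]: "cball xo D \<in> sets borel" by (intro borel_closed closed_cball)
  show "0 \<le> mean_miss M P \<alpha> \<beta> \<sigma>2 D xo l s"
    unfolding mean_miss_def by (intro divide_nonneg_nonneg integral_nonneg_AE) (auto simp: miss_prob_bounds)
  have "integrable lborel (indicat_real (cball xo D))"
    using emeasure_lborel_cball_finite[of xo D] by (intro integrable_real_indicator) auto
  then have "(\<integral>v. indicator (cball xo D) v * miss_prob M P \<alpha> \<beta> \<sigma>2 l s v \<partial>lborel) \<le> (\<integral>v. indicator (cball xo D) v \<partial>lborel)"
    by (rule integral_mono[OF integrable_disk_miss_prob]) (auto simp: indicator_def miss_prob_bounds)
  also have "\<dots> = pi * D\<^sup>2"
    using assms by (simp add: content_cball_2)
  finally show "mean_miss M P \<alpha> \<beta> \<sigma>2 D xo l s \<le> 1"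
    using assms by (simp add: mean_miss_def)
qed

section \<open>The hit probability\<close>

lemma poisson_weight_nonneg: "0 \<le> r \<Longrightarrow> 0 \<le> poisson_weight r k"
  by (simp add: poisson_weight_def)

lemma poisson_weight_sums: "poisson_weight r sums 1"
proof -
  have "(\<lambda>k. exp (- r) * (r ^ k /\<^sub>R fact k)) sums (exp (- r) * exp r)"
    by (intro sums_mult exp_converges)
  then show ?thesis
    by (simp add: poisson_weight_def[abs_def] divide_inverse mult_ac flip: exp_add)
qed

text \<open>Thinning in algebraic form: a Poisson total of mean x + y splits into independent parts
  of means x and y, and each point of the first part carries a factor q.\<close>

lemma poisson_weight_binomial:
  "exp (- (x + y)) * (x * q + y) ^ n / fact n = (\<Sum>k\<le>n. poisson_weight x k * poisson_weight y (n - k) * q ^ k)"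
proof -
  have "(x * q + y) ^ n / fact n = (\<Sum>k\<le>n. (x * q) ^ k * y ^ (n - k) * (real (n choose k) / fact n))"
    by (simp add: binomial_ring sum_divide_distrib mult_ac)
  also have "\<dots> = (\<Sum>k\<le>n. (x * q) ^ k * y ^ (n - k) * (1 / (fact k * fact (n - k))))"
    by (intro sum.cong refl arg_cong2[where f = "(*)"]) (simp add: binomial_fact)
  finally have "exp (- (x + y)) * ((x * q + y) ^ n / fact n) =
      (\<Sum>k\<le>n. exp (- (x + y)) * ((x * q) ^ k * y ^ (n - k) * (1 / (fact k * fact (n - k)))))"
    by (simp add: sum_distrib_left)
  also have "\<dots> = (\<Sum>k\<le>n. poisson_weight x k * poisson_weight y (n - k) * q ^ k)"
  proof -
    have "exp (- (x + y)) = exp (- x) * exp (- y)"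
      by (simp flip: exp_add)
    then show ?thesis
      by (simp add: poisson_weight_def power_mult_distrib mult_ac)
  qed
  finally show ?thesis
    by simp
qed

text \<open>If \<open>R M k\<close> stood in every term, the series would be a Cauchy product whose
  second factor sums to 1. The true series differs only for n < M, so a finite correction, reindexed
  by n = k + t, gives the formula.\<close>

lemma thinned_poisson_series:
  fixes R :: "nat \<Rightarrow> nat \<Rightarrow> real" and a b :: "nat \<Rightarrow> real"
  assumes a: "\<And>k. 0 \<le> a k" "a sums 1" and b: "\<And>k. 0 \<le> b k" "b sums 1" and R: "\<And>k. \<bar>R M k\<bar> \<le> 1"
    and Q: "(\<lambda>n. \<Sum>k\<le>n. R (min M n) k * a k * b (n - k)) sums Q"
  shows "summable (\<lambda>k. R M k * a k * (1 - (\<Sum>t<M - k. b t)))"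
    and "Q = (\<Sum>k<M. \<Sum>t<M - k. R (k + t) k * a k * b t) + (\<Sum>k. R M k * a k * (1 - (\<Sum>t<M - k. b t)))"
proof -
  have tri: "(\<Sum>n<M. \<Sum>k\<le>n. f k (n - k)) = (\<Sum>k<M. \<Sum>t<M - k. f k t)" for f :: "nat \<Rightarrow> nat \<Rightarrow> real"
  proof -
    have "(\<Sum>k<M. \<Sum>t<M - k. f k t) = (\<Sum>(k, t)\<in>(SIGMA k:{..<M}. {..<M - k}). f k t)"
      by (rule sum.Sigma) auto
    also have "(SIGMA k:{..<M}. {..<M - k}) = {(k, t). k + t < M}"
      by auto
    finally show ?thesis
      by (simp add: sum.triangle_reindex)
  qed
  have sa: "summable (\<lambda>k. norm (R M k * a k))"
  proof (rule summable_comparison_test)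
    show "\<exists>N. \<forall>n\<ge>N. norm (norm (R M n * a n)) \<le> a n"
      using R a(1) by (auto simp: abs_mult intro!: mult_left_le_one_le)
  qed (use a(2) in \<open>simp add: sums_iff\<close>)
  have sb: "summable (\<lambda>k. norm (b k))"
    using b by (simp add: sums_iff)
  have C: "(\<lambda>n. \<Sum>k\<le>n. R M k * a k * b (n - k)) sums (\<Sum>k. R M k * a k)"
    using Cauchy_product_sums[OF sa sb] b by (simp add: sums_iff)
  \<comment> \<open>For k at least M the inner sum is empty, by truncated subtraction, so the series
    is a finite sum.\<close>
  have F: "(\<lambda>k. R M k * a k * (\<Sum>t<M - k. b t)) sums (\<Sum>k<M. R M k * a k * (\<Sum>t<M - k. b t))"
    by (rule sums_finite) auto
  have G: "(\<lambda>k. R M k * a k * (1 - (\<Sum>t<M - k. b t))) sums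
      ((\<Sum>k. R M k * a k) - (\<Sum>k<M. R M k * a k * (\<Sum>t<M - k. b t)))"
    using sums_diff[OF summable_sums[OF summable_norm_cancel[OF sa]] F] by (simp add: right_diff_distrib)
  show "summable (\<lambda>k. R M k * a k * (1 - (\<Sum>t<M - k. b t)))"
    using G by (rule sums_summable)
  \<comment> \<open>The correction: replace \<open>R M k\<close> by \<open>R n k\<close> in the
    finitely many terms where \<open>min M n = n\<close>.\<close>
  have "(\<lambda>n. if n < M then (\<Sum>k\<le>n. R n k * a k * b (n - k)) - (\<Sum>k\<le>n. R M k * a k * b (n - k)) else 0) sums
      (\<Sum>n<M. (\<Sum>k\<le>n. R n k * a k * b (n - k)) - (\<Sum>k\<le>n. R M k * a k * b (n - k)))"
    using sums_If_finite_set[of "{..<M}" "\<lambda>n. (\<Sum>k\<le>n. R n k * a k * b (n - k)) - (\<Sum>k\<le>n. R M k * a k * b (n - k))"]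
    by simp
  from sums_add[OF this C] have "(\<lambda>n. \<Sum>k\<le>n. R (min M n) k * a k * b (n - k)) sums
     ((\<Sum>n<M. (\<Sum>k\<le>n. R n k * a k * b (n - k)) - (\<Sum>k\<le>n. R M k * a k * b (n - k))) + (\<Sum>k. R M k * a k))"
    by (rule back_subst[where P = "\<lambda>f. f sums _"]) (auto simp: min_def)
  with Q have "Q = (\<Sum>n<M. \<Sum>k\<le>n. R n k * a k * b (n - k)) - (\<Sum>n<M. \<Sum>k\<le>n. R M k * a k * b (n - k)) + (\<Sum>k. R M k * a k)"
    by (simp add: sums_iff sum_subtractf)
  also have "(\<Sum>n<M. \<Sum>k\<le>n. R n k * a k * b (n - k)) = (\<Sum>n<M. \<Sum>k\<le>n. R (k + (n - k)) k * a k * b (n - k))"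
    by (intro sum.cong) auto
  also have "\<dots> = (\<Sum>k<M. \<Sum>t<M - k. R (k + t) k * a k * b t)"
    by (rule tri)
  also have "(\<Sum>n<M. \<Sum>k\<le>n. R M k * a k * b (n - k)) = (\<Sum>k<M. R M k * a k * (\<Sum>t<M - k. b t))"
    using tri[of "\<lambda>k t. R M k * a k * b t"] by (simp add: sum_distrib_left)
  finally show "Q = (\<Sum>k<M. \<Sum>t<M - k. R (k + t) k * a k * b t) + (\<Sum>k. R M k * a k * (1 - (\<Sum>t<M - k. b t)))"
    using G by (simp add: sums_iff)
qed

section \<open>Misses on a fixed caching pattern\<close>

locale best_selection =
  prob_space S for S :: "'w measure" +
  fixes lam D P \<beta> \<sigma>2 \<alpha> p :: real and M :: nat and xo :: "real ^ 2"
    and num :: "'w \<Rightarrow> nat" and loc :: "nat \<Rightarrow> 'w \<Rightarrow> real ^ 2" and c :: "nat \<Rightarrow> 'w \<Rightarrow> bool"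
    and g :: "nat \<Rightarrow> 'w \<Rightarrow> real" and Io :: "'w \<Rightarrow> ennreal"
  assumes params: "0 < lam" "0 < D" "norm xo \<le> D" "0 < P" "0 < \<beta>" "0 \<le> \<sigma>2" "0 \<le> p" "p \<le> 1"
    and rus_ppp: "homogeneous_ppp S lam (cball xo D) (points num loc)"
    and rus_inj: "AE \<omega> in S. inj_on (\<lambda>j. loc j \<omega>) {..<num \<omega>}"
    and caching_marks:
      "cond_indep_marks S config_space (\<lambda>\<omega>. (num \<omega>, \<lambda>j. loc j \<omega>))
         (count_space UNIV) (\<lambda>\<omega>. {..<num \<omega>}) (\<lambda>_ _. measure_pmf (bernoulli_pmf p)) c"
    and gain_marks:
      "cond_indep_marks S (config_space \<Otimes>\<^sub>M (seq_space (count_space UNIV) \<Otimes>\<^sub>M borel))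
         (\<lambda>\<omega>. ((num \<omega>, \<lambda>j. loc j \<omega>), ((\<lambda>j. c j \<omega>), Io \<omega>)))
         borel (caching num c) (\<lambda>_ \<omega>. gain_law M (min M (card (points num loc \<omega>)))) g"
    and interference_indep:
      "indep_rvs S
         (config_space \<Otimes>\<^sub>M seq_space (count_space UNIV))
         (\<lambda>\<omega>. ((num \<omega>, \<lambda>j. loc j \<omega>), (\<lambda>j. c j \<omega>)))
         borel Io"
begin

lemma config_measurable: "(\<lambda>\<omega>. (num \<omega>, \<lambda>j. loc j \<omega>)) \<in> S \<rightarrow>\<^sub>M config_space"
  using caching_marks by (simp add: cond_indep_marks_def)

lemma num_measurable [measurable]: "num \<in> S \<rightarrow>\<^sub>M count_space UNIV"
  using measurable_compose[OF config_measurable measurable_fst] by simp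

lemma loc_measurable [measurable]: "loc j \<in> S \<rightarrow>\<^sub>M borel"
  using measurable_compose[OF measurable_compose[OF config_measurable measurable_snd] measurable_component_singleton[of j UNIV]]
  by simp

lemma c_measurable [measurable]: "c j \<in> S \<rightarrow>\<^sub>M count_space UNIV"
  using caching_marks by (simp add: cond_indep_marks_def)

lemma g_measurable [measurable]: "g j \<in> S \<rightarrow>\<^sub>M borel"
  using gain_marks by (simp add: cond_indep_marks_def)

lemma Io_measurable [measurable]: "Io \<in> S \<rightarrow>\<^sub>M borel"
  using interference_indep by (simp add: indep_rvs_def)

sublocale ppp_on S lam "cball xo D" num loc
  by unfold_locales (use rus_ppp rus_inj in \<open>auto intro: borel_closed\<close>)

text \<open>On such an event the random index set \<open>caching num c\<close> is the constant J, as
  \<open>cond_indep_marks\<close> demands of the marks it tests.\<close>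

definition cache_event :: "nat \<Rightarrow> nat set \<Rightarrow> 'w set" where
  "cache_event n J = {\<omega>\<in>space S. num \<omega> = n \<and> (\<forall>j<n. c j \<omega> \<longleftrightarrow> j \<in> J)}"

lemma cache_event_sets [measurable]: "cache_event n J \<in> sets S"
  unfolding cache_event_def by measurable

abbreviation miss :: "nat \<Rightarrow> ennreal \<Rightarrow> real ^ 2 \<Rightarrow> real" where
  "miss n \<equiv> miss_prob M P \<alpha> \<beta> \<sigma>2 (min M n)"

text \<open>Division by the common denominator is monotone, so the maximum stays below the threshold
  iff every candidate does. Without caching RUs the right side is vacuous, matching the convention
  that there is no hit.\<close>

lemma no_hit_iff:
  "\<not> (caching num c \<omega> \<noteq> {} \<and> ennreal \<beta> < sinr_best P \<alpha> \<sigma>2 num loc c g Io \<omega>) \<longleftrightarrow>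
     (\<forall>j\<in>caching num c \<omega>. g j \<omega> \<in> miss_set P \<alpha> \<beta> \<sigma>2 (loc j \<omega>) (Io \<omega>))"
proof (cases "caching num c \<omega> = {}")
  case False
  let ?A = "(\<lambda>j. ennreal (P * g j \<omega> * norm (loc j \<omega>) powr - \<alpha>)) ` caching num c \<omega>"
  let ?s = "ennreal \<sigma>2 + Io \<omega>"
  have fin: "finite ?A" "?A \<noteq> {}"
    using False by (auto simp: caching_def)
  have "Max ?A / ?s \<le> ennreal \<beta> \<longleftrightarrow> (\<forall>x\<in>?A. x / ?s \<le> ennreal \<beta>)"
  proof
    assume "Max ?A / ?s \<le> ennreal \<beta>"
    moreover have "x / ?s \<le> Max ?A / ?s" if "x \<in> ?A" for x
      by (intro divide_right_mono_ennreal Max_ge fin that)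
    ultimately show "\<forall>x\<in>?A. x / ?s \<le> ennreal \<beta>"
      by (meson order_trans)
  next
    assume "\<forall>x\<in>?A. x / ?s \<le> ennreal \<beta>"
    then show "Max ?A / ?s \<le> ennreal \<beta>"
      using Max_in[OF fin] by (rule bspec)
  qed
  then show ?thesis
    using False by (auto simp: sinr_best_def miss_set_def not_less)
qed simp

lemma emeasure_miss_cache_event:
  assumes J: "J \<subseteq> {..<n}"
  shows "emeasure S {\<omega>\<in>cache_event n J. \<forall>j\<in>J. g j \<omega> \<in> miss_set P \<alpha> \<beta> \<sigma>2 (loc j \<omega>) (Io \<omega>)} =
    (\<integral>\<^sup>+\<omega>. indicator (cache_event n J) \<omega> * (\<Prod>j\<in>J. ennreal (miss n (Io \<omega>) (loc j \<omega>))) \<partial>S)"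
proof -
  let ?N = "config_space \<Otimes>\<^sub>M (seq_space (count_space (UNIV :: bool set)) \<Otimes>\<^sub>M (borel :: ennreal measure)) :: ((nat \<times> (nat \<Rightarrow> real ^ 2)) \<times> (nat \<Rightarrow> bool) \<times> ennreal) measure"
  let ?V = "\<lambda>\<omega>. ((num \<omega>, \<lambda>j. loc j \<omega>), ((\<lambda>j. c j \<omega>), Io \<omega>))"
  define E where "E = {v \<in> space ?N. fst (fst v) = n \<and> (\<forall>j<n. fst (snd v) j \<longleftrightarrow> j \<in> J)}"
  define Q where "Q j = {z \<in> space (?N \<Otimes>\<^sub>M borel). snd z \<in> miss_set P \<alpha> \<beta> \<sigma>2 (snd (fst (fst z)) j) (snd (snd (fst z)))}" for j
  have V: "?V \<in> S \<rightarrow>\<^sub>M ?N"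
    using gain_marks by (simp add: cond_indep_marks_def)
  have VE: "?V \<omega> \<in> E \<longleftrightarrow> \<omega> \<in> cache_event n J" if "\<omega> \<in> space S" for \<omega>
    using measurable_space[OF V that] that by (auto simp: E_def cache_event_def)
  have caching_J: "caching num c \<omega> = J" if "\<omega> \<in> cache_event n J" for \<omega>
    using that J by (auto simp: cache_event_def caching_def)
  have VQ: "(?V \<omega>, x) \<in> Q j \<longleftrightarrow> x \<in> miss_set P \<alpha> \<beta> \<sigma>2 (loc j \<omega>) (Io \<omega>)" if "\<omega> \<in> space S" for \<omega> x j
    using measurable_space[OF V that] by (auto simp: Q_def space_pair_measure)
  have E: "E \<in> sets ?N"
    unfolding E_def by measurable
  have Q: "Q j \<in> sets (?N \<Otimes>\<^sub>M borel)" for j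
    unfolding Q_def miss_set_def mem_Collect_eq by measurable
  have "emeasure S {\<omega>\<in>cache_event n J. \<forall>j\<in>J. g j \<omega> \<in> miss_set P \<alpha> \<beta> \<sigma>2 (loc j \<omega>) (Io \<omega>)} =
      emeasure S {\<omega>\<in>space S. ?V \<omega> \<in> E \<and> (\<forall>j\<in>J. (?V \<omega>, g j \<omega>) \<in> Q j)}"
    by (rule arg_cong2[where f = emeasure]) (auto simp: VE VQ cache_event_def)
  also have "\<dots> = (\<integral>\<^sup>+\<omega>. indicator E (?V \<omega>) * (\<Prod>j\<in>J. emeasure (gain_law M (min M n)) (Pair (?V \<omega>) -` Q j)) \<partial>S)"
  proof (rule cond_indep_marks_common_law[OF prob_space_axioms gain_marks])
    show "finite J" using J by (rule finite_subset) simp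
    show "J \<subseteq> caching num c \<omega>" if "\<omega> \<in> space S" "?V \<omega> \<in> E" for \<omega>
      using that VE caching_J by blast
    show "prob_space (gain_law M (min M n))" by (rule prob_space_gain_law)
    show "sets (gain_law M (min M n)) = sets borel" by simp
    \<comment> \<open>The gain law is stated with the number of points; it equals the number n of
      labels only where the enumeration is injective.\<close>
    show "AE \<omega> in S. ?V \<omega> \<in> E \<longrightarrow> (\<forall>j\<in>J. gain_law M (min M (card (points num loc \<omega>))) = gain_law M (min M n))"
      using rus_inj
      by (auto elim!: eventually_mono simp: points_def card_image E_def)
  qed (use E Q in auto)
  also have "\<dots> = (\<integral>\<^sup>+\<omega>. indicator (cache_event n J) \<omega> * (\<Prod>j\<in>J. ennreal (miss n (Io \<omega>) (loc j \<omega>))) \<partial>S)"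
  proof (intro nn_integral_cong)
    fix \<omega> assume \<omega>: "\<omega> \<in> space S"
    have "Pair (?V \<omega>) -` Q j = miss_set P \<alpha> \<beta> \<sigma>2 (loc j \<omega>) (Io \<omega>)" for j
      using VQ[OF \<omega>] by auto
    then show "indicator E (?V \<omega>) * (\<Prod>j\<in>J. emeasure (gain_law M (min M n)) (Pair (?V \<omega>) -` Q j)) =
        indicator (cache_event n J) \<omega> * (\<Prod>j\<in>J. ennreal (miss n (Io \<omega>) (loc j \<omega>)))"
      using VE[OF \<omega>] by (simp add: emeasure_miss_set indicator_def)
  qed
  finally show ?thesis .
qed

lemma nn_integral_indep_interference:
  assumes J: "J \<subseteq> {..<n}"
  shows "(\<integral>\<^sup>+\<omega>. indicator (cache_event n J) \<omega> * (\<Prod>j\<in>J. ennreal (miss n (Io \<omega>) (loc j \<omega>))) \<partial>S) =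
    (\<integral>\<^sup>+\<omega>'. \<integral>\<^sup>+\<omega>. indicator (cache_event n J) \<omega> * (\<Prod>j\<in>J. ennreal (miss n (Io \<omega>') (loc j \<omega>))) \<partial>S \<partial>S)"
proof -
  let ?N = "config_space \<Otimes>\<^sub>M seq_space (count_space (UNIV :: bool set)) :: ((nat \<times> (nat \<Rightarrow> real ^ 2)) \<times> (nat \<Rightarrow> bool)) measure"
  define A where "A = {z \<in> space (?N \<Otimes>\<^sub>M (borel :: ennreal measure)). fst (fst (fst z)) = n \<and> (\<forall>j<n. snd (fst z) j \<longleftrightarrow> j \<in> J)}"
  have [measurable]: "A \<in> sets (?N \<Otimes>\<^sub>M borel)"
    unfolding A_def by measurable
  let ?f = "\<lambda>z. indicator A z * (\<Prod>j\<in>J. ennreal (miss n (snd z) (snd (fst (fst z)) j)))"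
  have "?f \<in> borel_measurable (?N \<Otimes>\<^sub>M borel)"
    by measurable
  note indep = nn_integral_indep_rvs[OF prob_space_axioms interference_indep this]
  have V: "(\<lambda>\<omega>. ((num \<omega>, \<lambda>j. loc j \<omega>), (\<lambda>j. c j \<omega>))) \<in> S \<rightarrow>\<^sub>M ?N"
    using interference_indep by (simp add: indep_rvs_def)
  have "?f (((num \<omega>, \<lambda>j. loc j \<omega>), (\<lambda>j. c j \<omega>)), s) =
      indicator (cache_event n J) \<omega> * (\<Prod>j\<in>J. ennreal (miss n s (loc j \<omega>)))" if "\<omega> \<in> space S" for \<omega> s
    using that measurable_space[OF V that] by (simp add: A_def cache_event_def space_pair_measure indicator_def)
  with indep show ?thesis
    by (simp cong: nn_integral_cong)
qed

text \<open>Given the locations the caching marks are independent Bernoulli variables, so a pattern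
  has the same probability for every configuration of n RUs and factors out of the integral.\<close>

lemma nn_integral_cache_event:
  assumes J: "J \<subseteq> {..<n}" and [measurable]: "h \<in> borel_measurable borel"
  shows "(\<integral>\<^sup>+\<omega>. indicator (cache_event n J) \<omega> * (\<Prod>j\<in>J. h (loc j \<omega>)) \<partial>S) =
    (\<Prod>j\<in>J. ennreal p) * (\<Prod>j\<in>{..<n} - J. ennreal (1 - p)) *
    (\<integral>\<^sup>+\<omega>. indicator {\<omega>\<in>space S. num \<omega> = n} \<omega> * (\<Prod>j\<in>J. h (loc j \<omega>)) \<partial>S)"
proof -
  let ?V = "\<lambda>\<omega>. (num \<omega>, \<lambda>j. loc j \<omega>)"
  let ?r = "(\<Prod>j\<in>J. ennreal p) * (\<Prod>j\<in>{..<n} - J. ennreal (1 - p))"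
  have "(\<integral>\<^sup>+\<omega>. (\<Prod>j\<in>J. h (snd (?V \<omega>) j)) * indicator (cache_event n J) \<omega> \<partial>S) =
      ?r * (\<integral>\<^sup>+\<omega>. (\<Prod>j\<in>J. h (snd (?V \<omega>) j)) * indicator {\<omega>\<in>space S. num \<omega> = n} \<omega> \<partial>S)"
  proof (rule nn_integral_proportional_on[OF config_measurable])
    fix E :: "(nat \<times> (nat \<Rightarrow> real ^ 2)) set" assume [measurable]: "E \<in> sets config_space"
    define F where "F = {v \<in> space config_space. v \<in> E \<and> fst v = n}"
    have F: "F \<in> sets config_space"
      unfolding F_def by measurable
    have VF: "?V \<omega> \<in> F \<longleftrightarrow> ?V \<omega> \<in> E \<and> num \<omega> = n" if "\<omega> \<in> space S" for \<omega>
      using measurable_space[OF config_measurable that] by (auto simp: F_def)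
    \<comment> \<open>The set \<open>{j \<in> J}\<close> is the singleton of a truth value, namely
      the one the pattern prescribes for mark j.\<close>
    have "emeasure S {\<omega>\<in>space S. ?V \<omega> \<in> E \<and> \<omega> \<in> cache_event n J} =
        emeasure S {\<omega>\<in>space S. ?V \<omega> \<in> F \<and> (\<forall>j\<in>{..<n}. c j \<omega> \<in> {j \<in> J})}"
      by (rule arg_cong2[where f = emeasure]) (auto simp: VF cache_event_def)
    also have "\<dots> = (\<integral>\<^sup>+\<omega>. indicator {\<omega>\<in>space S. ?V \<omega> \<in> F} \<omega> * (\<Prod>j<n. emeasure (measure_pmf (bernoulli_pmf p)) {j \<in> J}) \<partial>S)"
      by (rule caching_marks[unfolded cond_indep_marks_def, THEN conjunct2, THEN conjunct2, rule_format, OF F])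
        (auto simp: VF)
    also have "(\<Prod>j<n. emeasure (measure_pmf (bernoulli_pmf p)) {j \<in> J}) = (\<Prod>j<n. if j \<in> J then ennreal p else ennreal (1 - p))"
      using params by (intro prod.cong refl) (auto simp: emeasure_pmf_single)
    also have "\<dots> = ?r"
    proof -
      have "{..<n} \<inter> {j. j \<in> J} = J" "{..<n} \<inter> - {j. j \<in> J} = {..<n} - J"
        using J by auto
      then show ?thesis by (simp add: prod.If_cases)
    qed
    also have "(\<integral>\<^sup>+\<omega>. indicator {\<omega>\<in>space S. ?V \<omega> \<in> F} \<omega> * ?r \<partial>S) =
        ?r * emeasure S {\<omega>\<in>space S. ?V \<omega> \<in> E \<and> \<omega> \<in> {\<omega>\<in>space S. num \<omega> = n}}"
    proof -
      have "{\<omega>\<in>space S. ?V \<omega> \<in> F} \<in> sets S"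
        using measurable_sets[OF config_measurable F] by (simp add: vimage_def Int_def conj_commute)
      moreover have "{\<omega>\<in>space S. ?V \<omega> \<in> F} = {\<omega>\<in>space S. ?V \<omega> \<in> E \<and> \<omega> \<in> {\<omega>\<in>space S. num \<omega> = n}}"
        by (auto simp: VF)
      ultimately show ?thesis
        by (simp only: nn_integral_cmult_indicator mult.commute[of "indicator _ _" ?r])
    qed
    finally show "emeasure S {\<omega>\<in>space S. ?V \<omega> \<in> E \<and> \<omega> \<in> cache_event n J} =
        ?r * emeasure S {\<omega>\<in>space S. ?V \<omega> \<in> E \<and> \<omega> \<in> {\<omega>\<in>space S. num \<omega> = n}}" .
  qed auto
  then show ?thesis
    by (simp add: mult.commute)
qed

text \<open>The probability, at fixed interference s, of having n RUs and a miss; k counts the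
  caching RUs among them.\<close>

definition thinned_miss :: "nat \<Rightarrow> ennreal \<Rightarrow> real" where
  "thinned_miss n s = (\<Sum>k\<le>n. poisson_weight (lam * p * pi * D\<^sup>2) k * poisson_weight (lam * (1 - p) * pi * D\<^sup>2) (n - k) *
     mean_miss M P \<alpha> \<beta> \<sigma>2 D xo (min M n) s ^ k)"

lemma thinned_miss_nonneg: "0 \<le> thinned_miss n s"
  unfolding thinned_miss_def using params
  by (intro sum_nonneg mult_nonneg_nonneg poisson_weight_nonneg zero_le_power mean_miss_bounds) auto

text \<open>A single summand depends on how the points are labelled. Summed over all patterns, the
  integrand is the expansion over subsets of a product of p h + (1 - p) over all n points, to which
  the symmetric formula applies.\<close>

lemma sum_cache_event:
  "(\<Sum>J\<in>Pow {..<n}. \<integral>\<^sup>+\<omega>. indicator (cache_event n J) \<omega> * (\<Prod>j\<in>J. ennreal (miss n s (loc j \<omega>))) \<partial>S) =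
    ennreal (thinned_miss n s)"
proof -
  have [measurable]: "cball xo D \<in> sets borel" by (intro borel_closed closed_cball)
  have "(\<Sum>J\<in>Pow {..<n}. \<integral>\<^sup>+\<omega>. indicator (cache_event n J) \<omega> * (\<Prod>j\<in>J. ennreal (miss n s (loc j \<omega>))) \<partial>S) =
     (\<Sum>J\<in>Pow {..<n}. \<integral>\<^sup>+\<omega>. (\<Prod>j\<in>J. ennreal p) * (\<Prod>j\<in>{..<n} - J. ennreal (1 - p)) *
        (indicator {\<omega>\<in>space S. num \<omega> = n} \<omega> * (\<Prod>j\<in>J. ennreal (miss n s (loc j \<omega>)))) \<partial>S)"
    by (intro sum.cong refl, subst nn_integral_cache_event, simp, simp, subst nn_integral_cmult) auto
  also have "\<dots> = (\<integral>\<^sup>+\<omega>. (\<Sum>J\<in>Pow {..<n}. (\<Prod>j\<in>J. ennreal p) * (\<Prod>j\<in>{..<n} - J. ennreal (1 - p)) *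
        (indicator {\<omega>\<in>space S. num \<omega> = n} \<omega> * (\<Prod>j\<in>J. ennreal (miss n s (loc j \<omega>))))) \<partial>S)"
    by (subst nn_integral_sum) auto
  also have "\<dots> = (\<integral>\<^sup>+\<omega>. ennreal ((\<Prod>j<n. p * miss n s (loc j \<omega>) + (1 - p)) * indicator {\<omega>\<in>space S. num \<omega> = n} \<omega>) \<partial>S)"
  proof (intro nn_integral_cong)
    fix \<omega>
    have "(\<Sum>J\<in>Pow {..<n}. (\<Prod>j\<in>J. ennreal p) * (\<Prod>j\<in>{..<n} - J. ennreal (1 - p)) *
        (indicator {\<omega>\<in>space S. num \<omega> = n} \<omega> * (\<Prod>j\<in>J. ennreal (miss n s (loc j \<omega>))))) =
        (\<Sum>J\<in>Pow {..<n}. (\<Prod>j\<in>J. ennreal p * ennreal (miss n s (loc j \<omega>))) * (\<Prod>j\<in>{..<n} - J. ennreal (1 - p))) *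
        indicator {\<omega>\<in>space S. num \<omega> = n} \<omega>"
      by (simp add: sum_distrib_left prod.distrib mult_ac)
    also have "\<dots> = (\<Prod>j<n. ennreal p * ennreal (miss n s (loc j \<omega>)) + ennreal (1 - p)) * indicator {\<omega>\<in>space S. num \<omega> = n} \<omega>"
      by (subst prod_add) simp_all
    also have "\<dots> = ennreal ((\<Prod>j<n. p * miss n s (loc j \<omega>) + (1 - p)) * indicator {\<omega>\<in>space S. num \<omega> = n} \<omega>)"
    proof -
      have nn: "0 \<le> p * miss n s (loc j \<omega>)" for j
        using params by (simp add: miss_prob_bounds)
      then have "ennreal p * ennreal (miss n s (loc j \<omega>)) + ennreal (1 - p) = ennreal (p * miss n s (loc j \<omega>) + (1 - p))" for j
        using params by (subst ennreal_plus) (auto simp: ennreal_mult miss_prob_bounds)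
      moreover have "(\<Prod>j<n. ennreal (p * miss n s (loc j \<omega>) + (1 - p))) = ennreal (\<Prod>j<n. p * miss n s (loc j \<omega>) + (1 - p))"
        using nn params by (intro prod_ennreal) (simp add: add_nonneg_nonneg)
      ultimately show ?thesis
        by (auto simp: indicator_def)
    qed
    finally show "(\<Sum>J\<in>Pow {..<n}. (\<Prod>j\<in>J. ennreal p) * (\<Prod>j\<in>{..<n} - J. ennreal (1 - p)) *
        (indicator {\<omega>\<in>space S. num \<omega> = n} \<omega> * (\<Prod>j\<in>J. ennreal (miss n s (loc j \<omega>))))) =
        ennreal ((\<Prod>j<n. p * miss n s (loc j \<omega>) + (1 - p)) * indicator {\<omega>\<in>space S. num \<omega> = n} \<omega>)" .
  qed
  also have "\<dots> = ennreal (\<integral>\<omega>. (\<Prod>j<n. p * miss n s (loc j \<omega>) + (1 - p)) * indicator {\<omega>\<in>space S. num \<omega> = n} \<omega> \<partial>S)"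
  proof (intro nn_integral_eq_integral integrable_const_bound[where B = 1] AE_I2)
    fix \<omega>
    have "0 \<le> p * miss n s (loc j \<omega>) + (1 - p)" "p * miss n s (loc j \<omega>) + (1 - p) \<le> 1" for j
      using params mult_left_le[OF miss_prob_bounds(2), of p] by (auto simp: miss_prob_bounds)
    then have "0 \<le> (\<Prod>j<n. p * miss n s (loc j \<omega>) + (1 - p))" "(\<Prod>j<n. p * miss n s (loc j \<omega>) + (1 - p)) \<le> 1"
      by (auto intro: prod_nonneg prod_le_1)
    then show "0 \<le> (\<Prod>j<n. p * miss n s (loc j \<omega>) + (1 - p)) * indicator {\<omega>\<in>space S. num \<omega> = n} \<omega>"
      "norm ((\<Prod>j<n. p * miss n s (loc j \<omega>) + (1 - p)) * indicator {\<omega>\<in>space S. num \<omega> = n} \<omega>) \<le> 1"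
      by (auto simp: indicator_def)
  qed measurable
  also have "(\<integral>\<omega>. (\<Prod>j<n. p * miss n s (loc j \<omega>) + (1 - p)) * indicator {\<omega>\<in>space S. num \<omega> = n} \<omega> \<partial>S) =
     exp (- (lam * measure lborel (cball xo D))) *
     (lam * (\<integral>v. indicator (cball xo D) v * (p * miss n s v + (1 - p)) \<partial>lborel)) ^ n / fact n"
    using params mult_left_le[OF miss_prob_bounds(2), of p]
    by (intro integral_prod_num_eq) (auto simp: miss_prob_bounds)
  also have "(\<integral>v. indicator (cball xo D) v * (p * miss n s v + (1 - p)) \<partial>lborel) =
     pi * D\<^sup>2 * (p * mean_miss M P \<alpha> \<beta> \<sigma>2 D xo (min M n) s + (1 - p))"
  proof -
    have i: "integrable lborel (indicat_real (cball xo D))"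
      using emeasure_lborel_cball_finite[of xo D] by (intro integrable_real_indicator) auto
    have "(\<integral>v. indicator (cball xo D) v * (p * miss n s v + (1 - p)) \<partial>lborel) =
        (\<integral>v. p * (indicator (cball xo D) v * miss n s v) + (1 - p) * indicat_real (cball xo D) v \<partial>lborel)"
      by (intro Bochner_Integration.integral_cong refl) (simp add: algebra_simps)
    also have "\<dots> = p * (\<integral>v. indicator (cball xo D) v * miss n s v \<partial>lborel) + (1 - p) * measure lborel (cball xo D)"
    proof -
      have "(\<integral>v. p * (indicator (cball xo D) v * miss n s v) + (1 - p) * indicat_real (cball xo D) v \<partial>lborel) =
          (\<integral>v. p * (indicator (cball xo D) v * miss n s v) \<partial>lborel) + (\<integral>v. (1 - p) * indicat_real (cball xo D) v \<partial>lborel)"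
        by (intro Bochner_Integration.integral_add integrable_mult_right integrable_disk_miss_prob i)
      also have "(\<integral>v. (1 - p) * indicat_real (cball xo D) v \<partial>lborel) = (1 - p) * measure lborel (cball xo D)"
        by (subst integral_mult_right_zero) (simp del: mult_eq_0_iff)
      finally show ?thesis
        by simp
    qed
    also have "\<dots> = pi * D\<^sup>2 * (p * ((\<integral>v. indicator (cball xo D) v * miss n s v \<partial>lborel) / (pi * D\<^sup>2)) + (1 - p))"
      using params by (simp add: content_cball_2 distrib_left)
    finally show ?thesis
      unfolding mean_miss_def .
  qed
  \<comment> \<open>The mean number of RUs is the sum of the means of the caching and the
    non-caching ones, so the thinning identity separates the two Poisson weights.\<close>
  also have "exp (- (lam * measure lborel (cball xo D))) *
     (lam * (pi * D\<^sup>2 * (p * mean_miss M P \<alpha> \<beta> \<sigma>2 D xo (min M n) s + (1 - p)))) ^ n / fact n = thinned_miss n s"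
    unfolding thinned_miss_def using params
    by (subst poisson_weight_binomial[symmetric]) (simp add: content_cball_2 algebra_simps)
  finally show ?thesis .
qed

section \<open>Measurability of the miss event and summation over the number of RUs\<close>

definition no_hit :: "'w set" where
  "no_hit = {\<omega>\<in>space S. \<not> (caching num c \<omega> \<noteq> {} \<and> ennreal \<beta> < sinr_best P \<alpha> \<sigma>2 num loc c g Io \<omega>)}"

lemma no_hit_cache_event:
  assumes "J \<subseteq> {..<n}"
  shows "no_hit \<inter> cache_event n J = {\<omega>\<in>cache_event n J. \<forall>j\<in>J. g j \<omega> \<in> miss_set P \<alpha> \<beta> \<sigma>2 (loc j \<omega>) (Io \<omega>)}"
proof -
  have "caching num c \<omega> = J" if "\<omega> \<in> cache_event n J" for \<omega>
    using that assms by (auto simp: cache_event_def caching_def)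
  then show ?thesis
    unfolding no_hit_def no_hit_iff by (auto simp: cache_event_def)
qed

text \<open>The maximum in \<open>sinr_best\<close> runs over a random index set; on one pattern the
  set is constant, so measurability is established there and carried over to countable
  unions.\<close>

lemma no_hit_cache_event_sets:
  assumes "J \<subseteq> {..<n}"
  shows "no_hit \<inter> cache_event n J \<in> sets S"
  unfolding no_hit_cache_event[OF assms] miss_set_def mem_Collect_eq using finite_subset[OF assms] by measurable

lemma num_eq_Un_cache_event: "{\<omega>\<in>space S. num \<omega> = n} = (\<Union>J\<in>Pow {..<n}. cache_event n J)"
proof (intro equalityI subsetI)
  fix \<omega> assume "\<omega> \<in> {\<omega>\<in>space S. num \<omega> = n}"
  then have "\<omega> \<in> cache_event n {j. j < n \<and> c j \<omega>}" "{j. j < n \<and> c j \<omega>} \<in> Pow {..<n}"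
    by (auto simp: cache_event_def)
  then show "\<omega> \<in> (\<Union>J\<in>Pow {..<n}. cache_event n J)"
    by blast
qed (auto simp: cache_event_def)

lemma no_hit_num_sets: "no_hit \<inter> {\<omega>\<in>space S. num \<omega> = n} \<in> sets S"
  unfolding num_eq_Un_cache_event Int_UN_distrib
  by (intro sets.finite_UN no_hit_cache_event_sets) auto

lemma no_hit_sets [measurable]: "no_hit \<in> sets S"
proof -
  have "no_hit = (\<Union>n. no_hit \<inter> {\<omega>\<in>space S. num \<omega> = n})"
    unfolding no_hit_def by auto
  also have "\<dots> \<in> sets S"
    by (intro sets.countable_UN image_subsetI no_hit_num_sets)
  finally show ?thesis .
qed

lemma emeasure_no_hit_num:
  "emeasure S (no_hit \<inter> {\<omega>\<in>space S. num \<omega> = n}) = (\<integral>\<^sup>+\<omega>. ennreal (thinned_miss n (Io \<omega>)) \<partial>S)"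
proof -
  have "emeasure S (no_hit \<inter> {\<omega>\<in>space S. num \<omega> = n}) = (\<Sum>J\<in>Pow {..<n}. emeasure S (no_hit \<inter> cache_event n J))"
    unfolding num_eq_Un_cache_event Int_UN_distrib
  proof (intro sum_emeasure[symmetric])
    show "disjoint_family_on (\<lambda>J. no_hit \<inter> cache_event n J) (Pow {..<n})"
    proof (unfold disjoint_family_on_def, intro ballI impI)
      fix J K assume JK: "J \<in> Pow {..<n}" "K \<in> Pow {..<n}" "J \<noteq> K"
      then obtain j where "j < n" "(j \<in> J) \<noteq> (j \<in> K)" by blast
      then show "no_hit \<inter> cache_event n J \<inter> (no_hit \<inter> cache_event n K) = {}"
        unfolding cache_event_def by blast
    qed
  qed (auto intro: no_hit_cache_event_sets)
  also have "\<dots> = (\<Sum>J\<in>Pow {..<n}. \<integral>\<^sup>+\<omega>'. \<integral>\<^sup>+\<omega>. indicator (cache_event n J) \<omega> * (\<Prod>j\<in>J. ennreal (miss n (Io \<omega>') (loc j \<omega>))) \<partial>S \<partial>S)"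
    by (intro sum.cong refl)
      (simp only: Pow_iff no_hit_cache_event emeasure_miss_cache_event nn_integral_indep_interference)
  \<comment> \<open>The sum over patterns has to move inside the integral over the interference,
    since only the whole sum has been evaluated.\<close>
  also have "\<dots> = (\<integral>\<^sup>+\<omega>'. (\<Sum>J\<in>Pow {..<n}. \<integral>\<^sup>+\<omega>. indicator (cache_event n J) \<omega> * (\<Prod>j\<in>J. ennreal (miss n (Io \<omega>') (loc j \<omega>))) \<partial>S) \<partial>S)"
    by (intro nn_integral_sum[symmetric] borel_measurable_nn_integral) measurable
  also have "\<dots> = (\<integral>\<^sup>+\<omega>. ennreal (thinned_miss n (Io \<omega>)) \<partial>S)"
    by (simp only: sum_cache_event)
  finally show ?thesis .
qed

lemma integrable_mean_miss_power: "integrable S (\<lambda>\<omega>. mean_miss M P \<alpha> \<beta> \<sigma>2 D xo l (Io \<omega>) ^ k)"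
  using params mean_miss_bounds[of D]
  by (intro integrable_const_bound[where B = 1]) (auto simp: power_le_one abs_of_nonneg)

lemma R_coeff_eq: "R_coeff S Io M P \<beta> \<alpha> \<sigma>2 D (norm xo) l k = (\<integral>\<omega>. mean_miss M P \<alpha> \<beta> \<sigma>2 D xo l (Io \<omega>) ^ k \<partial>S)"
  unfolding R_coeff_def using params
  by (intro Bochner_Integration.integral_cong refl) (simp add: mean_miss_eq)

lemma abs_R_coeff_le_1: "\<bar>R_coeff S Io M P \<beta> \<alpha> \<sigma>2 D (norm xo) l k\<bar> \<le> 1"
proof -
  let ?m = "\<lambda>\<omega>. mean_miss M P \<alpha> \<beta> \<sigma>2 D xo l (Io \<omega>) ^ k"
  have b: "0 \<le> ?m \<omega>" "?m \<omega> \<le> 1" for \<omega>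
    using params by (auto simp: mean_miss_bounds intro!: zero_le_power power_le_one)
  have "(\<integral>\<omega>. ?m \<omega> \<partial>S) \<le> (\<integral>\<omega>. 1 \<partial>S)"
    by (intro integral_mono integrable_mean_miss_power b) simp
  moreover have "0 \<le> (\<integral>\<omega>. ?m \<omega> \<partial>S)"
    using b by (intro integral_nonneg_AE) simp
  ultimately show ?thesis
    by (simp add: R_coeff_eq prob_space)
qed

lemma no_hit_sums:
  "(\<lambda>n. \<Sum>k\<le>n. R_coeff S Io M P \<beta> \<alpha> \<sigma>2 D (norm xo) (min M n) k * poisson_weight (lam * p * pi * D\<^sup>2) k *
      poisson_weight (lam * (1 - p) * pi * D\<^sup>2) (n - k)) sums measure S no_hit"
proof -
  have i: "integrable S (\<lambda>\<omega>. thinned_miss n (Io \<omega>))" for n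
    unfolding thinned_miss_def by (intro Bochner_Integration.integrable_sum integrable_mult_right integrable_mean_miss_power)
  have "measure S (no_hit \<inter> {\<omega>\<in>space S. num \<omega> = n}) = (\<integral>\<omega>. thinned_miss n (Io \<omega>) \<partial>S)" for n
    using emeasure_no_hit_num[of n]
    by (simp add: measure_def nn_integral_eq_integral[OF i] thinned_miss_nonneg integral_nonneg_AE)
  also have "(\<integral>\<omega>. thinned_miss n (Io \<omega>) \<partial>S) = (\<Sum>k\<le>n. R_coeff S Io M P \<beta> \<alpha> \<sigma>2 D (norm xo) (min M n) k * poisson_weight (lam * p * pi * D\<^sup>2) k *
      poisson_weight (lam * (1 - p) * pi * D\<^sup>2) (n - k))" for n
    unfolding thinned_miss_def R_coeff_eq
    by (subst Bochner_Integration.integral_sum)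
       (auto intro!: integrable_mult_right integrable_mean_miss_power simp: mult_ac)
  finally have m: "measure S (no_hit \<inter> {\<omega>\<in>space S. num \<omega> = n}) = (\<Sum>k\<le>n. R_coeff S Io M P \<beta> \<alpha> \<sigma>2 D (norm xo) (min M n) k * poisson_weight (lam * p * pi * D\<^sup>2) k *
      poisson_weight (lam * (1 - p) * pi * D\<^sup>2) (n - k))" for n .
  have "no_hit = (\<Union>n. no_hit \<inter> {\<omega>\<in>space S. num \<omega> = n})"
    unfolding no_hit_def by auto
  moreover have "(\<lambda>n. measure S (no_hit \<inter> {\<omega>\<in>space S. num \<omega> = n})) sums measure S (\<Union>n. no_hit \<inter> {\<omega>\<in>space S. num \<omega> = n})"
    by (intro finite_measure_UNION) (auto simp: disjoint_family_on_def intro: no_hit_num_sets)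
  ultimately show ?thesis
    by (simp only: m)
qed

theorem hit_probability:
  defines "R \<equiv> R_coeff S Io M P \<beta> \<alpha> \<sigma>2 D (norm xo)"
    and "a \<equiv> poisson_weight (lam * p * pi * D\<^sup>2)" and "b \<equiv> poisson_weight (lam * (1 - p) * pi * D\<^sup>2)"
  shows "summable (\<lambda>k. R M k * a k * (1 - (\<Sum>t<M - k. b t)))"
    and "measure S {\<omega>\<in>space S. caching num c \<omega> \<noteq> {} \<and> ennreal \<beta> < sinr_best P \<alpha> \<sigma>2 num loc c g Io \<omega>} =
      1 - (\<Sum>k<M. \<Sum>t<M - k. R (k + t) k * a k * b t) - (\<Sum>k. R M k * a k * (1 - (\<Sum>t<M - k. b t)))"
proof -
  have ab: "\<And>k. 0 \<le> a k" "a sums 1" "\<And>k. 0 \<le> b k" "b sums 1"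
    unfolding a_def b_def using params by (auto intro: poisson_weight_nonneg poisson_weight_sums)
  have "\<bar>R M k\<bar> \<le> 1" for k
    unfolding R_def by (rule abs_R_coeff_le_1)
  note series = thinned_poisson_series[OF ab this no_hit_sums[folded R_def a_def b_def]]
  show "summable (\<lambda>k. R M k * a k * (1 - (\<Sum>t<M - k. b t)))"
    by (rule series(1))
  have "{\<omega>\<in>space S. caching num c \<omega> \<noteq> {} \<and> ennreal \<beta> < sinr_best P \<alpha> \<sigma>2 num loc c g Io \<omega>} = space S - no_hit"
    unfolding no_hit_def by auto
  then show "measure S {\<omega>\<in>space S. caching num c \<omega> \<noteq> {} \<and> ennreal \<beta> < sinr_best P \<alpha> \<sigma>2 num loc c g Io \<omega>} =
      1 - (\<Sum>k<M. \<Sum>t<M - k. R (k + t) k * a k * b t) - (\<Sum>k. R M k * a k * (1 - (\<Sum>t<M - k. b t)))"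
    using series(2) by (simp add: prob_compl)
qed

end

theorem mainTheorem6:
  fixes S :: "'w measure"
    and lam lam_p D P \<beta> \<sigma>2 dg \<alpha>i \<alpha>o p :: real
    and M :: nat
    and xo :: "real ^ 2"
    (* representative cloud: number of RUs, locations, caching marks for the file, gains *)
    and num :: "'w \<Rightarrow> nat"
    and loc :: "nat \<Rightarrow> 'w \<Rightarrow> real ^ 2"
    and c :: "nat \<Rightarrow> 'w \<Rightarrow> bool"
    and g :: "nat \<Rightarrow> 'w \<Rightarrow> real"
    (* other clouds: centers, numbers of RUs, RU positions relative to the center,
       active RUs, fading *)
    and ctr :: "nat \<Rightarrow> 'w \<Rightarrow> real ^ 2"
    and cnum :: "nat \<Rightarrow> 'w \<Rightarrow> nat"
    and off :: "nat \<Rightarrow> nat \<Rightarrow> 'w \<Rightarrow> real ^ 2"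
    and act :: "nat \<Rightarrow> 'w \<Rightarrow> nat set"
    and fad :: "nat \<Rightarrow> nat \<Rightarrow> 'w \<Rightarrow> real"
    and Io :: "'w \<Rightarrow> ennreal"
    and R :: "nat \<Rightarrow> nat \<Rightarrow> real"
    and a b :: "nat \<Rightarrow> real"
  assumes S: "prob_space S"
    and params: "0 < lam" "0 < lam_p" "0 < D" "0 < P" "0 < \<beta>" "0 \<le> \<sigma>2" "0 \<le> dg"
      "0 < \<alpha>i" "\<alpha>i < \<alpha>o" "1 \<le> M" "0 \<le> p" "p \<le> 1" "norm xo \<le> D"
    and Io_def: "Io = interference P \<alpha>o ctr off act fad"
    (* the representative cloud *)
    and rus_ppp: "homogeneous_ppp S lam (cball xo D) (points num loc)"
    and rus_inj: "AE \<omega> in S. inj_on (\<lambda>j. loc j \<omega>) {..<num \<omega>}"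
    and caching_marks:
      "cond_indep_marks S config_space (\<lambda>\<omega>. (num \<omega>, \<lambda>j. loc j \<omega>))
         (count_space UNIV) (\<lambda>\<omega>. {..<num \<omega>}) (\<lambda>_ _. measure_pmf (bernoulli_pmf p)) c"
    and gain_marks:
      "cond_indep_marks S (config_space \<Otimes>\<^sub>M (seq_space (count_space UNIV) \<Otimes>\<^sub>M borel))
         (\<lambda>\<omega>. ((num \<omega>, \<lambda>j. loc j \<omega>), ((\<lambda>j. c j \<omega>), Io \<omega>)))
         borel (caching num c) (\<lambda>_ \<omega>. gain_law M (min M (card (points num loc \<omega>)))) g"
    (* the out of cloud interference *)
    and centers_ppp: "homogeneous_ppp S lam_p UNIV (\<lambda>\<omega>. range (\<lambda>n. ctr n \<omega>))"
    and centers_inj: "AE \<omega> in S. inj (\<lambda>n. ctr n \<omega>)"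
    and clouds_ppp: "\<And>n. homogeneous_ppp S lam (cball 0 D) (points (cnum n) (off n))"
    and clouds_inj: "\<And>n. AE \<omega> in S. inj_on (\<lambda>j. off n j \<omega>) {..<cnum n \<omega>}"
    and clouds_indep:
      "prob_space.indep_vars S (\<lambda>_. config_space) (\<lambda>n \<omega>. (cnum n \<omega>, \<lambda>j. off n j \<omega>)) UNIV"
    and clouds_indep_centers:
      "indep_rvs S (seq_space borel) (\<lambda>\<omega> n. ctr n \<omega>)
         (seq_space config_space) (\<lambda>\<omega> n. (cnum n \<omega>, \<lambda>j. off n j \<omega>))"
    and active_marks:
      "cond_indep_marks S (seq_space borel \<Otimes>\<^sub>M seq_space config_space)
         (\<lambda>\<omega>. ((\<lambda>n. ctr n \<omega>), (\<lambda>n. (cnum n \<omega>, \<lambda>j. off n j \<omega>))))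
         (count_space UNIV) (\<lambda>_. UNIV)
         (\<lambda>n \<omega>. measure_pmf (pmf_of_set (active_choices M (far_rus dg ctr cnum off n \<omega>)))) act"
    and fading_marks:
      "cond_indep_marks S
         ((seq_space borel \<Otimes>\<^sub>M seq_space config_space) \<Otimes>\<^sub>M seq_space (count_space UNIV))
         (\<lambda>\<omega>. (((\<lambda>n. ctr n \<omega>), (\<lambda>n. (cnum n \<omega>, \<lambda>j. off n j \<omega>))), (\<lambda>n. act n \<omega>)))
         borel (\<lambda>\<omega>. {(n, j). j \<in> act n \<omega>}) (\<lambda>_ _. density lborel (exponential_density 1))
         (\<lambda>(n, j). fad n j)"
    and interference_indep:
      "indep_rvs S
         (config_space \<Otimes>\<^sub>M seq_space (count_space UNIV))
         (\<lambda>\<omega>. ((num \<omega>, \<lambda>j. loc j \<omega>), (\<lambda>j. c j \<omega>)))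
         borel Io"
    (* the quantities in the formula *)
    and R_def: "R = R_coeff S Io M P \<beta> \<alpha>i \<sigma>2 D (norm xo)"
    and a_def: "a = poisson_weight (lam * p * pi * D\<^sup>2)"
    and b_def: "b = poisson_weight (lam * (1 - p) * pi * D\<^sup>2)"
  shows "summable (\<lambda>k. R M k * a k * (1 - (\<Sum>t<M - k. b t))) \<and>
         measure S {\<omega>\<in>space S. caching num c \<omega> \<noteq> {} \<and>
            ennreal \<beta> < sinr_best P \<alpha>i \<sigma>2 num loc c g Io \<omega>} =
         1 - (\<Sum>k<M. \<Sum>t<M - k. R (k + t) k * a k * b t)
           - (\<Sum>k. R M k * a k * (1 - (\<Sum>t<M - k. b t)))"
proof -
  interpret best_selection S lam D P \<beta> \<sigma>2 \<alpha>i p M xo num loc c g Io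
    by (intro best_selection.intro best_selection_axioms.intro S params rus_ppp rus_inj
        caching_marks gain_marks interference_indep)
  show ?thesis
    using hit_probability unfolding R_def a_def b_def by blast
qed

end
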